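(* Let $d\ge 2$ be an integer and let $(G_n)$ be a sequence of finite $d$-regular graphs with essentially large girth. Then the matching measures $\rho_{G_n}$ converge weakly to the probability measure on $\mathbb R$ with density \[f_d(x)=\frac{d\sqrt{4(d-1)-x^2}}{2\pi(d^2-x^2)}\,\chi_{[-2\sqrt{d-1},\,2\sqrt{d-1}]}(x).\]
   Context: A sequence $(G_n)$ of finite graphs has essentially large girth if for every fixed $k\ge 3$ the number of cycles of length $k$ in $G_n$ is $o(v(G_n))$ as $n\to\infty$, where $v(G)$ is the number of vertices. The matching polynomial of $G$ is $\mu(G,x)=\sum_k(-1)^k m_k(G)x^{v(G)-2k}$ where $m_k(G)$ is the number of $k$-edge matchings, and the matching measure $\rho_G$ is the uniform probability measure on the roots of $\mu(G,x)$ counted with multiplicity. $\chi_A$ denotes the indicator function of $A$. *)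

theory Defs
  imports "HOL-Probability.Probability" "HOL-Library.Landau_Symbols"
    "HOL-Library.Disjoint_Sets" "HOL-Computational_Algebra.Polynomial"
begin

text \<open>Graphs are simple and undirected; an edge is a two-element set of vertices.\<close>

record 'a graph =
  verts :: "'a set"
  edges :: "'a set set"

text \<open>The vertex set is nonempty, since the empty graph has no matching measure (its matching
  polynomial is the constant 1).\<close>

definition finite_graph :: "'a graph \<Rightarrow> bool" where
  "finite_graph G \<longleftrightarrow> finite (verts G) \<and> verts G \<noteq> {} \<and>
     edges G \<subseteq> {e. e \<subseteq> verts G \<and> card e = 2}"

definition num_verts :: "'a graph \<Rightarrow> nat" where
  "num_verts G = card (verts G)"

definition regular_graph :: "nat \<Rightarrow> 'a graph \<Rightarrow> bool" where
  "regular_graph d G \<longleftrightarrow> (\<forall>v\<in>verts G. card {e \<in> edges G. v \<in> e} = d)"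

text \<open>Cycles are counted as subgraphs, hence without a base point or an orientation; a cycle of
  length at least 3 is determined by its edge set. This is only used for \<open>k \<ge> 3\<close>.\<close>

definition cycles :: "'a graph \<Rightarrow> nat \<Rightarrow> 'a set set set" where
  "cycles G k = {C. C \<subseteq> edges G \<and>
     (\<exists>xs. distinct xs \<and> length xs = k \<and> C = {{xs ! i, xs ! (Suc i mod k)} | i. i < k})}"

definition essentially_large_girth :: "(nat \<Rightarrow> 'a graph) \<Rightarrow> bool" where
  "essentially_large_girth G \<longleftrightarrow>
     (\<forall>k\<ge>3. (\<lambda>n. real (card (cycles (G n) k))) \<in> o(\<lambda>n. real (num_verts (G n))))"

definition matchings :: "'a graph \<Rightarrow> nat \<Rightarrow> 'a set set set" where
  "matchings G k = {M. M \<subseteq> edges G \<and> disjoint M \<and> card M = k}"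

text \<open>The sum stops where \<open>2 * k\<close> exceeds the number of vertices: there are no larger matchings.\<close>

definition matching_poly :: "'a graph \<Rightarrow> real poly" where
  "matching_poly G = (\<Sum>k\<le>num_verts G div 2.
     monom ((-1) ^ k * real (card (matchings G k))) (num_verts G - 2 * k))"

text \<open>By the Heilmann--Lieb theorem all complex roots of the matching polynomial are real, so
  the multiset of its real roots is the full multiset of its roots and has \<open>num_verts G\<close> elements.
  The \<open>distr\<close> serves to obtain a measure on the Borel sets rather than on all sets of reals.\<close>

definition matching_measure :: "'a graph \<Rightarrow> real measure" where
  "matching_measure G =
     distr (measure_pmf (pmf_of_multiset (proots (matching_poly G)))) borel (\<lambda>x. x)"

definition limit_density :: "nat \<Rightarrow> real \<Rightarrow> real" where
  "limit_density d x = real d * sqrt (4 * (real d - 1) - x\<^sup>2) / (2 * pi * ((real d)\<^sup>2 - x\<^sup>2)) *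
     indicator {- 2 * sqrt (real d - 1)..2 * sqrt (real d - 1)} x"

definition limit_measure :: "nat \<Rightarrow> real measure" where
  "limit_measure d = density lborel (\<lambda>x. ennreal (limit_density d x))"

end

theory Submission
  imports Defs "HOL-Computational_Algebra.Fundamental_Theorem_Algebra"
begin

text \<open>The ratios \<open>\<mu>(G - v) / \<mu>(G)\<close> satisfy the continued fraction
  \<open>R(G, v) = 1 / (z - (\<Sum>u\<sim>v. R(G - v, u)))\<close>. In the upper half plane it shows that \<open>\<mu>\<close> is
  real-rooted. For real \<open>\<bar>z\<bar> \<ge> 2 d\<close> it gives \<open>\<bar>R\<bar> \<le> 1 / d\<close>, so all roots lie in \<open>[-2 d, 2 d]\<close>, and
  it is a contraction there: at a vertex without short cycles nearby, \<open>R\<close> is exponentially close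
  to its value on the infinite \<open>d\<close>-regular tree. Essentially large girth says that all but
  \<open>o(v(G))\<close> vertices are of this kind. Since the sum of \<open>\<mu>(G - v)\<close> over all \<open>v\<close> is \<open>\<mu>'(G)\<close>, the
  average of \<open>R\<close> over the vertices is the Stieltjes transform of the matching measure; hence these
  transforms converge for large real \<open>z\<close> to that of the limit measure. The supports being uniformly
  bounded, the moments converge, and with them the integrals of all continuous functions.\<close>

section \<open>Weak convergence from Stieltjes transforms\<close>

lemma (in real_distribution) abs_integral_le:
  fixes f :: "real \<Rightarrow> real"
  assumes "f \<in> borel_measurable borel" "AE x in M. \<bar>x\<bar> \<le> K" "\<And>x. \<bar>x\<bar> \<le> K \<Longrightarrow> \<bar>f x\<bar> \<le> B"
  shows "integrable M f" "\<bar>integral\<^sup>L M f\<bar> \<le> B"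
proof -
  have meas: "f \<in> borel_measurable M" using assms(1) by simp
  have ae: "AE x in M. norm (f x) \<le> B" using assms(2) by eventually_elim (use assms(3) in auto)
  show int: "integrable M f"
    by (rule integrable_const_bound[OF ae meas])
  have "\<bar>integral\<^sup>L M f\<bar> \<le> (\<integral>x. \<bar>f x\<bar> \<partial>M)" using integral_norm_bound[of M f] by simp
  also have "\<dots> \<le> (\<integral>x. B \<partial>M)"
    by (rule integral_mono_AE) (use int ae in auto)
  also have "\<dots> = B" using prob_space by simp
  finally show "\<bar>integral\<^sup>L M f\<bar> \<le> B" .
qed

lemma LIMSEQ_uniform_approx:
  fixes X :: "nat \<Rightarrow> real"
  assumes "\<And>e. e > 0 \<Longrightarrow> \<exists>Y l. Y \<longlonglongrightarrow> l \<and> (\<forall>\<^sub>F n in sequentially. \<bar>X n - Y n\<bar> \<le> e) \<and> \<bar>L - l\<bar> \<le> e"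
  shows "X \<longlonglongrightarrow> L"
proof (rule tendstoI)
  fix e :: real assume "e > 0"
  then obtain Y l where Y: "Y \<longlonglongrightarrow> l" "\<forall>\<^sub>F n in sequentially. \<bar>X n - Y n\<bar> \<le> e/4" "\<bar>L - l\<bar> \<le> e/4"
    using assms[of "e/4"] by auto
  have "\<forall>\<^sub>F n in sequentially. dist (Y n) l < e/4"
    using Y(1) \<open>e > 0\<close> by (auto dest: tendstoD[of _ _ _ "e/4"])
  with Y(2) show "\<forall>\<^sub>F n in sequentially. dist (X n) L < e"
  proof eventually_elim
    case (elim n)
    then show ?case using Y(3) \<open>e > 0\<close> unfolding dist_real_def by linarith
  qed
qed

lemma moments_imp_weak_conv_m:
  fixes Ms :: "nat \<Rightarrow> real measure" and M :: "real measure"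
  assumes Ms: "\<And>n. real_distribution (Ms n)" and M: "real_distribution M"
    and supp: "\<And>n. AE x in Ms n. \<bar>x\<bar> \<le> K" "AE x in M. \<bar>x\<bar> \<le> K"
    and moments: "\<And>k. (\<lambda>n. \<integral>x. x ^ k \<partial>Ms n) \<longlonglongrightarrow> (\<integral>x. x ^ k \<partial>M)"
  shows "weak_conv_m Ms M"
proof (rule integral_bdd_continuous_conv_imp_weak_conv[OF Ms M])
  fix f :: "real \<Rightarrow> real"
  assume cont: "\<And>x. isCont f x" and f1: "\<And>x. \<bar>f x\<bar> \<le> 1"
  have fm: "f \<in> borel_measurable borel"
    using cont by (intro borel_measurable_continuous_onI continuous_at_imp_continuous_on) auto
  show "(\<lambda>n. integral\<^sup>L (Ms n) f) \<longlonglongrightarrow> integral\<^sup>L M f"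
  proof (rule LIMSEQ_uniform_approx)
    fix e :: real assume "e > 0"
    then obtain g where g: "real_polynomial_function g" "\<And>x. x \<in> {-K..K} \<Longrightarrow> \<bar>f x - g x\<bar> < e"
      using Stone_Weierstrass_real_polynomial_function[of "{-K..K}" f e] cont
      by (metis compact_Icc continuous_at_imp_continuous_on)
    then obtain a N where ga: "g = (\<lambda>x. \<Sum>i\<le>N. a i * x ^ i)"
      unfolding real_polynomial_function_iff_sum by auto
    have gm: "g \<in> borel_measurable borel" unfolding ga by measurable
    have pw: "integrable D (\<lambda>x. x ^ k)" if "real_distribution D" "AE x in D. \<bar>x\<bar> \<le> K" for D k
      by (rule real_distribution.abs_integral_le(1)[OF that(1) _ that(2), where B = "K ^ k"])
        (auto simp: power_abs intro!: power_mono)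
    have gint: "integral\<^sup>L D g = (\<Sum>i\<le>N. a i * (\<integral>x. x ^ i \<partial>D))" "integrable D g"
      if "real_distribution D" "AE x in D. \<bar>x\<bar> \<le> K" for D
      using pw[OF that] unfolding ga by auto
    have fint: "integrable D f" if "real_distribution D" "AE x in D. \<bar>x\<bar> \<le> K" for D
      by (rule real_distribution.abs_integral_le(1)[OF that(1) fm that(2), where B = 1]) (rule f1)
    have bd: "\<bar>integral\<^sup>L D f - integral\<^sup>L D g\<bar> \<le> e"
      if D: "real_distribution D" "AE x in D. \<bar>x\<bar> \<le> K" for D
    proof -
      have "\<bar>f x - g x\<bar> \<le> e" if "\<bar>x\<bar> \<le> K" for x using that by (intro less_imp_le g(2)) auto
      then have "\<bar>integral\<^sup>L D (\<lambda>x. f x - g x)\<bar> \<le> e"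
        using fm gm by (intro real_distribution.abs_integral_le(2)[OF D(1) _ D(2)]) auto
      then show ?thesis using fint[OF D] gint(2)[OF D] by simp
    qed
    have "(\<lambda>n. integral\<^sup>L (Ms n) g) \<longlonglongrightarrow> integral\<^sup>L M g"
      using gint(1)[OF Ms supp(1)] gint(1)[OF M supp(2)]
      by (auto intro!: tendsto_sum tendsto_mult moments)
    then show "\<exists>Y l. Y \<longlonglongrightarrow> l \<and>
        (\<forall>\<^sub>F n in sequentially. \<bar>integral\<^sup>L (Ms n) f - Y n\<bar> \<le> e) \<and> \<bar>integral\<^sup>L M f - l\<bar> \<le> e"
      using bd Ms M supp by (intro exI[of _ "\<lambda>n. integral\<^sup>L (Ms n) g"] exI[of _ "integral\<^sup>L M g"]) auto
  qed
qed

lemma geometric_kernel_bounds: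
  fixes K w x :: real
  assumes "0 < w" "w * (2 * K) < 1" "\<bar>x\<bar> \<le> K"
  shows "1/2 < 1 - w * x" "\<bar>x ^ k / (1 - w * x)\<bar> \<le> 2 * K ^ k"
proof -
  have "w * x \<le> w * K" using assms by (intro mult_left_mono) auto
  moreover have "w * (2 * K) = 2 * (w * K)" by simp
  ultimately show *: "1/2 < 1 - w * x" using assms(2) by linarith
  have "\<bar>x ^ k\<bar> \<le> K ^ k" using assms by (auto simp: power_abs intro!: power_mono)
  moreover have "K ^ k * 1 \<le> K ^ k * (2 * (1 - w * x))"
    using * assms by (intro mult_left_mono) auto
  ultimately show "\<bar>x ^ k / (1 - w * x)\<bar> \<le> 2 * K ^ k"
    using * by (simp add: abs_divide pos_divide_le_eq algebra_simps)
qed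

text \<open>With \<open>H k w\<close> the integral of \<open>x ^ k / (1 - w * x)\<close>, the identity
  \<open>w * H (k + 1) w = H k w - \<integral> x ^ k\<close> lets one pass from \<open>H k\<close> to the \<open>k\<close>-th moment (as \<open>w\<close> tends
  to 0) and from both to \<open>H (k + 1)\<close>.\<close>

lemma stieltjes_imp_moments:
  fixes Ms :: "nat \<Rightarrow> real measure" and M :: "real measure"
  assumes Ms: "\<And>n. real_distribution (Ms n)" and M: "real_distribution M" and K: "K > 0"
    and supp: "\<And>n. AE x in Ms n. \<bar>x\<bar> \<le> K" "AE x in M. \<bar>x\<bar> \<le> K"
    and stieltjes: "\<And>z. z > 2 * K \<Longrightarrow> (\<lambda>n. \<integral>x. 1 / (z - x) \<partial>Ms n) \<longlonglongrightarrow> (\<integral>x. 1 / (z - x) \<partial>M)"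
  shows "(\<lambda>n. \<integral>x. x ^ k \<partial>Ms n) \<longlonglongrightarrow> (\<integral>x. x ^ k \<partial>M)"
proof -
  define H where "H D k w = (\<integral>x. x ^ k / (1 - w * x) \<partial>D)" for D :: "real measure" and k w
  define adm where "adm D \<longleftrightarrow> real_distribution D \<and> (AE x in D. \<bar>x\<bar> \<le> K)" for D
  have adm: "\<And>n. adm (Ms n)" "adm M" using Ms M supp by (auto simp: adm_def)
  have intp: "integrable D (\<lambda>x. x ^ k)" if "adm D" for D k
    using that unfolding adm_def
    by (intro real_distribution.abs_integral_le(1)[where B = "K ^ k" and K = K])
      (auto simp: power_abs intro!: power_mono)
  have intH: "integrable D (\<lambda>x. x ^ k / (1 - w * x))" "\<bar>H D k w\<bar> \<le> 2 * K ^ k"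
    if "adm D" "0 < w" "w * (2 * K) < 1" for D k w
    unfolding H_def
    using geometric_kernel_bounds(2)[OF that(2,3)] that(1) unfolding adm_def
    by (auto intro: real_distribution.abs_integral_le[where B = "2 * K ^ k" and K = K])
  have step: "w * H D (Suc k) w = H D k w - (\<integral>x. x ^ k \<partial>D)"
    if "adm D" "0 < w" "w * (2 * K) < 1" for D k w
  proof -
    have "w * H D (Suc k) w = (\<integral>x. w * (x ^ Suc k / (1 - w * x)) \<partial>D)"
      unfolding H_def by (rule integral_mult_right_zero[symmetric])
    also have "\<dots> = (\<integral>x. x ^ k / (1 - w * x) - x ^ k \<partial>D)"
    proof (rule integral_cong_AE)
      show "(\<lambda>x. w * (x ^ Suc k / (1 - w * x))) \<in> borel_measurable D"
        using intH(1)[OF that, of "Suc k"] by (intro borel_measurable_times) auto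
      show "(\<lambda>x. x ^ k / (1 - w * x) - x ^ k) \<in> borel_measurable D"
        using intH(1)[OF that, of k] intp[OF that(1), of k] by (intro borel_measurable_diff) auto
      have "AE x in D. \<bar>x\<bar> \<le> K" using that by (simp add: adm_def)
      then show "AE x in D. w * (x ^ Suc k / (1 - w * x)) = x ^ k / (1 - w * x) - x ^ k"
      proof eventually_elim
        case (elim x)
        then show ?case using geometric_kernel_bounds(1)[OF that(2,3), of x] by (simp add: field_simps)
      qed
    qed
    also have "\<dots> = H D k w - (\<integral>x. x ^ k \<partial>D)"
      unfolding H_def using intH(1)[OF that] intp[OF that(1)] by simp
    finally show ?thesis .
  qed
  have conv: "(\<lambda>n. \<integral>x. x ^ k \<partial>Ms n) \<longlonglongrightarrow> (\<integral>x. x ^ k \<partial>M)"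
    if lim: "\<And>w. 0 < w \<Longrightarrow> w * (2 * K) < 1 \<Longrightarrow> (\<lambda>n. H (Ms n) k w) \<longlonglongrightarrow> H M k w" for k
  proof (rule LIMSEQ_uniform_approx)
    fix e :: real assume "e > 0"
    define w where "w = min (1 / (4 * K)) (e / (2 * K ^ Suc k))"
    have Kk: "K ^ Suc k > 0" using K by simp
    have w0: "0 < w" using \<open>e > 0\<close> K Kk unfolding w_def by simp
    have "w * (2 * K) \<le> 1 / (4 * K) * (2 * K)" using K unfolding w_def by (intro mult_right_mono) auto
    then have w1: "w * (2 * K) < 1" using K by simp
    have w2: "w * (2 * K ^ Suc k) \<le> e"
    proof -
      have "w * (2 * K ^ Suc k) \<le> e / (2 * K ^ Suc k) * (2 * K ^ Suc k)"
        using Kk unfolding w_def by (intro mult_right_mono) auto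
      then show ?thesis using K by simp
    qed
    have "\<bar>(\<integral>x. x ^ k \<partial>D) - H D k w\<bar> \<le> e" if "adm D" for D
    proof -
      have "\<bar>(\<integral>x. x ^ k \<partial>D) - H D k w\<bar> = w * \<bar>H D (Suc k) w\<bar>"
        using step[OF that w0 w1, of k] w0 by (metis abs_minus_commute abs_mult abs_of_pos)
      also have "\<dots> \<le> w * (2 * K ^ Suc k)"
        using intH(2)[OF that w0 w1, of "Suc k"] w0 by (intro mult_left_mono) (auto simp del: power_Suc)
      finally show ?thesis using w2 by simp
    qed
    then show "\<exists>Y l. Y \<longlonglongrightarrow> l \<and>
        (\<forall>\<^sub>F n in sequentially. \<bar>(\<integral>x. x ^ k \<partial>Ms n) - Y n\<bar> \<le> e) \<and> \<bar>(\<integral>x. x ^ k \<partial>M) - l\<bar> \<le> e"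
      using lim[OF w0 w1] adm by (intro exI[of _ "\<lambda>n. H (Ms n) k w"] exI[of _ "H M k w"]) auto
  qed
  have "(\<lambda>n. H (Ms n) k w) \<longlonglongrightarrow> H M k w" if w: "0 < w" "w * (2 * K) < 1" for w k
    using w
  proof (induction k arbitrary: w)
    case 0
    have "H D 0 w = 1 / w * (\<integral>x. 1 / (1 / w - x) \<partial>D)" for D
      unfolding H_def integral_mult_right_zero[symmetric]
      using 0 by (intro Bochner_Integration.integral_cong) (auto simp: field_simps)
    moreover have "2 * K < 1 / w" using 0 by (simp add: field_simps)
    ultimately show ?case using 0 by (auto intro!: tendsto_divide stieltjes)
  next
    case (Suc k)
    have "H D (Suc k) w = (H D k w - (\<integral>x. x ^ k \<partial>D)) / w" if "adm D" for D
      using step[OF that Suc.prems, of k] Suc.prems by (simp add: field_simps)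
    then show ?case
      using adm conv[OF Suc.IH] Suc.IH[OF Suc.prems] Suc.prems by (auto intro!: tendsto_intros)
  qed
  then show ?thesis by (rule conv)
qed

section \<open>The limit measure\<close>

lemma DERIV_arcsin_scaled:
  fixes a x :: real
  assumes "\<bar>x\<bar> < a"
  shows "((\<lambda>x. arcsin (x / a)) has_real_derivative 1 / sqrt (a\<^sup>2 - x\<^sup>2)) (at x)"
proof -
  have a: "a > 0" using assms by auto
  have "1 - (x / a)\<^sup>2 = (a\<^sup>2 - x\<^sup>2) / a\<^sup>2" using a by (simp add: field_simps power2_eq_square)
  then have sq: "sqrt (1 - (x / a)\<^sup>2) = sqrt (a\<^sup>2 - x\<^sup>2) / a"
    using a by (simp add: real_sqrt_divide)
  have "((\<lambda>x. arcsin (x / a)) has_real_derivative inverse (sqrt (1 - (x / a)\<^sup>2)) * (1 / a)) (at x)"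
    using assms a by (intro DERIV_arcsin[THEN DERIV_chain2]) (auto intro!: derivative_eq_intros simp: field_simps)
  then show ?thesis unfolding sq using a by (simp add: field_simps)
qed

lemma DERIV_arcsin_moebius:
  fixes a x z :: real
  assumes x: "\<bar>x\<bar> < a" and z: "a < z"
  shows "((\<lambda>x. arcsin ((z * x - a\<^sup>2) / (a * (z - x)))) has_real_derivative
           sqrt (z\<^sup>2 - a\<^sup>2) / ((z - x) * sqrt (a\<^sup>2 - x\<^sup>2))) (at x)"
proof -
  define u where "u = (z * x - a\<^sup>2) / (a * (z - x))"
  define s where "s = sqrt (z\<^sup>2 - a\<^sup>2)"
  define y where "y = sqrt (a\<^sup>2 - x\<^sup>2)"
  have a: "a > 0" and zx: "z - x > 0" using assms by auto
  have "a\<^sup>2 < z\<^sup>2" using a z by (intro power_strict_mono) auto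
  then have s: "s > 0" "s\<^sup>2 = z\<^sup>2 - a\<^sup>2" by (auto simp: s_def)
  have "x\<^sup>2 < a\<^sup>2" using a x by (intro abs_square_less_1[THEN iffD2] power2_strict_mono) auto
  then have y: "y > 0" "y\<^sup>2 = a\<^sup>2 - x\<^sup>2" by (auto simp: y_def)
  have "1 - u\<^sup>2 = ((a * (z - x))\<^sup>2 - (z * x - a\<^sup>2)\<^sup>2) / (a * (z - x))\<^sup>2"
    using a zx unfolding u_def power_divide by (subst diff_divide_distrib) simp
  also have "(a * (z - x))\<^sup>2 - (z * x - a\<^sup>2)\<^sup>2 = (s * y)\<^sup>2"
    unfolding power_mult_distrib s(2) y(2) by algebra
  finally have u2: "1 - u\<^sup>2 = (s * y / (a * (z - x)))\<^sup>2" by (simp add: power_divide)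
  have pos: "s * y / (a * (z - x)) > 0" using a zx s y by simp
  have sq: "sqrt (1 - u\<^sup>2) = s * y / (a * (z - x))" unfolding u2 real_sqrt_abs using pos by (rule abs_of_pos)
  have "u\<^sup>2 < 1" using u2 pos by (smt (verit) zero_less_power)
  then have u1: "- 1 < u" "u < 1" using abs_square_less_1[of u] by auto
  have "((\<lambda>x. (z * x - a\<^sup>2) / (a * (z - x))) has_real_derivative
      (z * (a * (z - x)) - (z * x - a\<^sup>2) * (- a)) / (a * (z - x) * (a * (z - x)))) (at x)"
    using a zx by (auto intro!: derivative_eq_intros simp: algebra_simps)
  moreover have "z * (a * (z - x)) - (z * x - a\<^sup>2) * (- a) = a * s\<^sup>2"
    unfolding s(2) by (simp add: power2_eq_square algebra_simps)
  ultimately have "((\<lambda>x. (z * x - a\<^sup>2) / (a * (z - x))) has_real_derivative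
      a * s\<^sup>2 / (a * (z - x) * (a * (z - x)))) (at x)" by simp
  from DERIV_chain2[OF DERIV_arcsin[OF u1, unfolded u_def] this]
  have "((\<lambda>x. arcsin ((z * x - a\<^sup>2) / (a * (z - x)))) has_real_derivative
      inverse (sqrt (1 - u\<^sup>2)) * (a * s\<^sup>2 / (a * (z - x) * (a * (z - x))))) (at x)"
    by (simp add: u_def)
  also have "inverse (sqrt (1 - u\<^sup>2)) * (a * s\<^sup>2 / (a * (z - x) * (a * (z - x)))) = s / ((z - x) * y)"
  proof -
    have "inverse (s * y / (a * w)) * (a * s\<^sup>2 / (a * w * (a * w))) = s / (w * y)" if "w > 0" for w
      using that a s(1) y(1) by (simp add: field_simps power2_eq_square)
    from this[OF zx] show ?thesis unfolding sq .
  qed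
  finally show ?thesis unfolding s_def y_def .
qed

lemma DERIV_sqrt_circle:
  fixes a x :: real
  assumes "\<bar>x\<bar> < a"
  shows "((\<lambda>x. sqrt (a\<^sup>2 - x\<^sup>2)) has_real_derivative - x / sqrt (a\<^sup>2 - x\<^sup>2)) (at x)"
proof -
  have "x\<^sup>2 < a\<^sup>2" using assms by (simp add: abs_less_iff power2_strict_mono abs_le_square_iff)
  then show ?thesis by (auto intro!: derivative_eq_intros simp: field_simps)
qed

lemma has_integral_semicircle_kernel:
  fixes a z :: real
  assumes a: "a > 0" and z: "z \<ge> a"
  shows "((\<lambda>x. sqrt (a\<^sup>2 - x\<^sup>2) / (z - x)) has_integral pi * (z - sqrt (z\<^sup>2 - a\<^sup>2))) {-a..a}"
proof -
  define s where "s = sqrt (z\<^sup>2 - a\<^sup>2)"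
  define F where "F x = - sqrt (a\<^sup>2 - x\<^sup>2) + z * arcsin (x / a) -
    (if z = a then 0 else s * arcsin ((z * x - a\<^sup>2) / (a * (z - x))))" for x
  have "a\<^sup>2 \<le> z\<^sup>2" using a z by (intro power_mono) auto
  then have s2: "s\<^sup>2 = z\<^sup>2 - a\<^sup>2" by (auto simp: s_def)
  have s0: "s = 0" if "z = a" using that by (simp add: s_def)
  have deriv: "(F has_real_derivative sqrt (a\<^sup>2 - x\<^sup>2) / (z - x)) (at x)" if x: "x \<in> {-a<..<a}" for x
  proof -
    have xa: "\<bar>x\<bar> < a" using x by auto
    define y where "y = sqrt (a\<^sup>2 - x\<^sup>2)"
    have "x\<^sup>2 < a\<^sup>2" using xa by (simp add: abs_less_iff power2_strict_mono abs_le_square_iff)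
    then have y: "y > 0" "y\<^sup>2 = a\<^sup>2 - x\<^sup>2" by (auto simp: y_def)
    have zx: "z - x > 0" using x z by auto
    have "((\<lambda>x. if z = a then 0 else s * arcsin ((z * x - a\<^sup>2) / (a * (z - x)))) has_real_derivative
        s * (s / ((z - x) * y))) (at x)"
    proof (cases "z = a")
      case True
      then show ?thesis by (simp add: s0)
    next
      case False
      then show ?thesis
        using DERIV_cmult[OF DERIV_arcsin_moebius[OF xa, of z], of s] z unfolding s_def y_def by simp
    qed
    from DERIV_diff[OF DERIV_add[OF DERIV_minus[OF DERIV_sqrt_circle[OF xa]]
        DERIV_cmult[OF DERIV_arcsin_scaled[OF xa], of z]] this]
    have "(F has_real_derivative - (- x / y) + z * (1 / y) - s * (s / ((z - x) * y))) (at x)"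
      unfolding F_def y_def by simp
    also have "- (- x / y) + z * (1 / y) - s * (s / ((z - x) * y)) = ((x + z) * (z - x) - s\<^sup>2) / ((z - x) * y)"
      using zx y(1) by (simp add: field_simps power2_eq_square)
    also have "(x + z) * (z - x) - s\<^sup>2 = y\<^sup>2" unfolding s2 y by (simp add: power2_eq_square algebra_simps)
    also have "y\<^sup>2 / ((z - x) * y) = y / (z - x)" using y(1) by (simp add: power2_eq_square)
    finally show ?thesis unfolding y_def .
  qed
  have cont: "continuous_on {-a..a} F"
  proof (cases "z = a")
    case True
    then show ?thesis unfolding F_def using a by (auto intro!: continuous_intros simp: field_simps)
  next
    case False
    have "-1 \<le> (z * x - a\<^sup>2) / (a * (z - x)) \<and> (z * x - a\<^sup>2) / (a * (z - x)) \<le> 1" if "x \<in> {-a..a}" for x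
    proof -
      have zx: "a * (z - x) > 0" using that a z False by auto
      have "(z + a) * (a - x) \<ge> 0" "(z - a) * (x + a) \<ge> 0" using that a z by auto
      then have "- (a * (z - x)) \<le> z * x - a\<^sup>2" "z * x - a\<^sup>2 \<le> a * (z - x)"
        by (auto simp: algebra_simps power2_eq_square)
      then show ?thesis using zx by (simp add: pos_divide_le_eq pos_le_divide_eq)
    qed
    then show ?thesis unfolding F_def using a z False
      by (auto intro!: continuous_intros simp: field_simps)
  qed
  have "((\<lambda>x. sqrt (a\<^sup>2 - x\<^sup>2) / (z - x)) has_integral F a - F (- a)) {-a..a}"
    using a deriv cont
    by (intro fundamental_theorem_of_calculus_interior)
      (auto simp: has_real_derivative_iff_has_vector_derivative[symmetric])
  moreover have "F a - F (- a) = pi * (z - s)"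
  proof (cases "z = a")
    case True
    then show ?thesis using a s0 by (simp add: F_def)
  next
    case False
    have "(z * a - a\<^sup>2) / (a * (z - a)) = 1"
      using a z False by (simp add: field_simps power2_eq_square)
    moreover have "(z * (- a) - a\<^sup>2) / (a * (z - - a)) = - 1"
    proof -
      have "a * (z - - a) > 0" using a z by (intro mult_pos_pos) auto
      moreover have "z * (- a) - a\<^sup>2 = - (a * (z - - a))" by (simp add: algebra_simps power2_eq_square)
      moreover have "a \<noteq> 0" "z + a \<noteq> 0" using a z by auto
      ultimately show ?thesis by simp
    qed
    ultimately show ?thesis using a False by (simp add: F_def algebra_simps)
  qed
  ultimately show ?thesis by (simp add: s_def)
qed

lemma two_sqrt_bounds:
  assumes "d \<ge> 2"
  shows "(2 * sqrt (real d - 1))\<^sup>2 = 4 * (real d - 1)"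
    "(real d)\<^sup>2 - (2 * sqrt (real d - 1))\<^sup>2 = (real d - 2)\<^sup>2"
    "2 * sqrt (real d - 1) \<le> real d"
proof -
  show sq: "(2 * sqrt (real d - 1))\<^sup>2 = 4 * (real d - 1)"
    using assms by (simp add: power_mult_distrib)
  show eq: "(real d)\<^sup>2 - (2 * sqrt (real d - 1))\<^sup>2 = (real d - 2)\<^sup>2"
    unfolding sq by (simp add: power2_eq_square algebra_simps)
  have "0 \<le> (real d)\<^sup>2 - (2 * sqrt (real d - 1))\<^sup>2" unfolding eq by simp
  then have "(2 * sqrt (real d - 1))\<^sup>2 \<le> (real d)\<^sup>2" by simp
  then show "2 * sqrt (real d - 1) \<le> real d" by (rule power2_le_imp_le) simp
qed

lemma limit_density_eq:
  assumes d: "d \<ge> 2" and x: "\<bar>x\<bar> \<le> 2 * sqrt (real d - 1)"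
  shows "limit_density d x = (sqrt ((2 * sqrt (real d - 1))\<^sup>2 - x\<^sup>2) / (real d - x) +
    sqrt ((2 * sqrt (real d - 1))\<^sup>2 - x\<^sup>2) / (real d + x)) / (4 * pi)"
proof -
  define a where "a = 2 * sqrt (real d - 1)"
  define y where "y = sqrt (a\<^sup>2 - x\<^sup>2)"
  note a2 = two_sqrt_bounds(1)[OF d, folded a_def] and ad = two_sqrt_bounds(3)[OF d, folded a_def]
  have "limit_density d x = real d * y / (2 * pi * ((real d)\<^sup>2 - x\<^sup>2))"
    using x unfolding limit_density_def y_def a2 by (auto simp: indicator_def abs_le_iff)
  also have "\<dots> = (y / (real d - x) + y / (real d + x)) / (4 * pi)"
  proof (cases "\<bar>x\<bar> = a")
    case True
    then have "x\<^sup>2 = a\<^sup>2" by (metis power2_abs)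
    then show ?thesis by (simp add: y_def)
  next
    case False
    then have pos: "real d - x > 0" "real d + x > 0" using x ad unfolding a_def[symmetric] by linarith+
    have fac: "(real d)\<^sup>2 - x\<^sup>2 = (real d - x) * (real d + x)"
      by (simp add: power2_eq_square algebra_simps)
    have "y / p + y / q = y * (p + q) / (p * q)" if "p > 0" "q > 0" for p q :: real
      using that by (simp add: field_simps)
    note sum = this[OF pos]
    have "c * y / (2 * pi * w) = y * (2 * c) / w / (4 * pi)" for c w :: real
      by (cases "w = 0") (simp_all add: field_simps)
    moreover have "real d - x + (real d + x) = 2 * real d" by simp
    ultimately show ?thesis unfolding fac sum by metis
  qed
  finally show ?thesis unfolding y_def a_def .
qed

lemma limit_density_nonneg:
  assumes "d \<ge> 2"
  shows "limit_density d x \<ge> 0"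
proof (cases "\<bar>x\<bar> \<le> 2 * sqrt (real d - 1)")
  case True
  have "real d - x \<ge> 0" "real d + x \<ge> 0" using True two_sqrt_bounds(3)[OF assms] by auto
  moreover have "x\<^sup>2 \<le> (2 * sqrt (real d - 1))\<^sup>2"
    using power_mono[OF True, of 2] by simp
  ultimately have "0 \<le> sqrt ((2 * sqrt (real d - 1))\<^sup>2 - x\<^sup>2) / (real d - x)"
    "0 \<le> sqrt ((2 * sqrt (real d - 1))\<^sup>2 - x\<^sup>2) / (real d + x)"
    by (auto intro!: divide_nonneg_nonneg simp del: power_mult_distrib)
  then show ?thesis unfolding limit_density_eq[OF assms True] by simp
next
  case False
  then show ?thesis by (auto simp: limit_density_def indicator_def)
qed

lemma limit_density_has_integral:
  assumes d: "d \<ge> 2"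
  defines "a \<equiv> 2 * sqrt (real d - 1)"
  shows "(limit_density d has_integral 1) {-a..a}"
    and "z > real d \<Longrightarrow> ((\<lambda>x. limit_density d x * (1 / (z - x))) has_integral
      ((2 - real d) * z + real d * sqrt (z\<^sup>2 - 4 * (real d - 1))) / (2 * (z\<^sup>2 - (real d)\<^sup>2))) {-a..a}"
proof -
  define y where "y x = sqrt (a\<^sup>2 - x\<^sup>2)" for x
  have a: "a > 0" using d by (simp add: a_def)
  note a2 = two_sqrt_bounds(1)[OF d, folded a_def] and da = two_sqrt_bounds(2)[OF d, folded a_def]
    and ad = two_sqrt_bounds(3)[OF d, folded a_def]
  have dens: "limit_density d x = (y x / (real d - x) + y x / (real d + x)) / (4 * pi)" if "x \<in> {-a..a}" for x
    using limit_density_eq[OF d, of x] that unfolding y_def a_def by auto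
  have I1: "((\<lambda>x. y x / (real d - x)) has_integral 2 * pi) {-a..a}"
    using has_integral_semicircle_kernel[OF a ad] d unfolding da y_def by (simp add: mult.commute)
  then have "((\<lambda>x. y (-x) / (real d - - x)) has_integral 2 * pi) {-a..-(-a)}"
    by (subst has_integral_reflect_real) simp
  then have I2: "((\<lambda>x. y x / (real d + x)) has_integral 2 * pi) {-a..a}" by (simp add: y_def)
  have "((\<lambda>x. (y x / (real d - x) + y x / (real d + x)) / (4 * pi)) has_integral
      (2 * pi + 2 * pi) / (4 * pi)) {-a..a}"
    by (intro has_integral_divide has_integral_add I1 I2)
  then show "(limit_density d has_integral 1) {-a..a}"
    using dens by (subst has_integral_cong[OF dens]) auto
  assume z: "z > real d"
  define s where "s = sqrt (z\<^sup>2 - a\<^sup>2)"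
  have I3: "((\<lambda>x. y x / (z - x)) has_integral pi * (z - s)) {-a..a}"
    using has_integral_semicircle_kernel[OF a, of z] z ad unfolding s_def y_def by simp
  have zd: "z - real d > 0" "z + real d > 0" "z\<^sup>2 - (real d)\<^sup>2 = (z - real d) * (z + real d)"
    using z by (auto simp: power2_eq_square algebra_simps)
  have "((\<lambda>x. (y x / (real d - x) * (1 / (z - real d)) + y x / (real d + x) * (1 / (z + real d)) -
      y x / (z - x) * (2 * real d / (z\<^sup>2 - (real d)\<^sup>2))) / (4 * pi)) has_integral
      (2 * pi * (1 / (z - real d)) + 2 * pi * (1 / (z + real d)) -
      pi * (z - s) * (2 * real d / (z\<^sup>2 - (real d)\<^sup>2))) / (4 * pi)) {-a..a}"
    by (intro has_integral_divide has_integral_add has_integral_diff has_integral_mult_left I1 I2 I3)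
  also have "(2 * pi * (1 / (z - real d)) + 2 * pi * (1 / (z + real d)) -
      pi * (z - s) * (2 * real d / (z\<^sup>2 - (real d)\<^sup>2))) / (4 * pi) =
      ((2 - real d) * z + real d * s) / (2 * (z\<^sup>2 - (real d)\<^sup>2))"
    unfolding zd(3) using zd(1,2) by (simp add: divide_simps) (simp add: algebra_simps)
  finally show "((\<lambda>x. limit_density d x * (1 / (z - x))) has_integral
      ((2 - real d) * z + real d * sqrt (z\<^sup>2 - 4 * (real d - 1))) / (2 * (z\<^sup>2 - (real d)\<^sup>2))) {-a..a}"
    unfolding s_def a2
  proof (rule has_integral_eq[rotated])
    fix x assume x: "x \<in> {-a..a}"
    show "(y x / (real d - x) * (1 / (z - real d)) + y x / (real d + x) * (1 / (z + real d)) -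
      y x / (z - x) * (2 * real d / (z\<^sup>2 - (real d)\<^sup>2))) / (4 * pi) = limit_density d x * (1 / (z - x))"
    proof (cases "\<bar>x\<bar> = a")
      case True
      then have "x\<^sup>2 = a\<^sup>2" by (metis power2_abs)
      then show ?thesis unfolding dens[OF x] by (simp add: y_def)
    next
      case False
      then have pos: "real d - x > 0" "real d + x > 0" "z - x > 0"
        using x ad z by auto
      have *: "Y / p * (1 / u) + Y / q * (1 / v) - Y / r * ((v - u) / (u * v)) = (Y / p + Y / q) * (1 / r)"
        if "p > 0" "q > 0" "r > 0" "u > 0" "v > 0" "r = p + u" "r = v - q" for Y p q r u v :: real
      proof -
        have "Y / p + Y / u = Y * r / (p * u)"
          unfolding that(6) using that(1,4) by (simp add: field_simps)
        moreover have "Y / q - Y / v = Y * r / (q * v)"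
          unfolding that(7) using that(2,5) by (simp add: field_simps)
        ultimately have "Y / p * (1 / u) = (Y / p + Y / u) / r" "Y / q * (1 / v) = (Y / q - Y / v) / r"
          using that(3) by simp_all
        moreover have "Y / r * ((v - u) / (u * v)) = (Y / u - Y / v) / r"
          using that(3-5) by (simp add: field_simps)
        ultimately show ?thesis by (simp add: add_divide_distrib diff_divide_distrib)
      qed
      have "z + real d - (z - real d) = 2 * real d" by simp
      note e = *[OF pos zd(1,2), of "y x", unfolded this]
      show ?thesis unfolding dens[OF x] zd(3) by (subst e) simp_all
    qed
  qed
qed

lemma limit_density_measurable [measurable]: "limit_density d \<in> borel_measurable borel"
  unfolding limit_density_def by measurable

lemma real_distribution_limit_measure:
  assumes "d \<ge> 2"
  shows "real_distribution (limit_measure d)"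
proof -
  let ?I = "{-(2 * sqrt (real d - 1))..2 * sqrt (real d - 1)}"
  have "emeasure (limit_measure d) UNIV = (\<integral>\<^sup>+ x. ennreal (limit_density d x) * indicator ?I x \<partial>lborel)"
    unfolding limit_measure_def
    by (subst emeasure_density) (auto intro!: nn_integral_cong simp: limit_density_def indicator_def)
  also have "\<dots> = ennreal 1"
    by (rule nn_integral_has_integral_lebesgue'[OF _ limit_density_has_integral(1)[OF assms]])
      (rule limit_density_nonneg[OF assms])
  finally have "prob_space (limit_measure d)"
    by (intro prob_spaceI) (simp add: limit_measure_def)
  then show ?thesis
    by (simp add: real_distribution_def real_distribution_axioms_def limit_measure_def)
qed

lemma AE_limit_measure:
  assumes "d \<ge> 2"
  shows "AE x in limit_measure d. \<bar>x\<bar> \<le> 2 * real d"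
proof -
  have "\<bar>x\<bar> \<le> 2 * real d" if "limit_density d x > 0" for x
  proof -
    have "\<bar>x\<bar> \<le> 2 * sqrt (real d - 1)"
      using that by (cases "x \<in> {-2 * sqrt (real d - 1)..2 * sqrt (real d - 1)}") (auto simp: limit_density_def)
    then show ?thesis using two_sqrt_bounds(3)[OF assms] by linarith
  qed
  then show ?thesis unfolding limit_measure_def by (subst AE_density) auto
qed

lemma stieltjes_limit_measure:
  assumes d: "d \<ge> 2" and z: "z > real d"
  shows "(\<integral>x. 1 / (z - x) \<partial>limit_measure d) =
    ((2 - real d) * z + real d * sqrt (z\<^sup>2 - 4 * (real d - 1))) / (2 * (z\<^sup>2 - (real d)\<^sup>2))" (is "_ = ?m")
proof -
  let ?I = "{-(2 * sqrt (real d - 1))..2 * sqrt (real d - 1)}"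
  note ad = two_sqrt_bounds(3)[OF d]
  have nonneg: "limit_density d x * (1 / (z - x)) \<ge> 0" for x
  proof (cases "x \<in> ?I")
    case True
    then show ?thesis using limit_density_nonneg[OF d] ad z by auto
  next
    case False
    then show ?thesis by (auto simp: limit_density_def indicator_def)
  qed
  have "(\<integral>\<^sup>+ x. ennreal (limit_density d x * (1 / (z - x))) \<partial>lborel) =
      (\<integral>\<^sup>+ x. ennreal (limit_density d x * (1 / (z - x))) * indicator ?I x \<partial>lborel)"
    by (auto intro!: nn_integral_cong simp: limit_density_def indicator_def)
  also have "\<dots> = ennreal ?m"
    by (rule nn_integral_has_integral_lebesgue'[OF _ limit_density_has_integral(2)[OF d z]])
      (rule nonneg)
  finally have "has_bochner_integral lborel (\<lambda>x. limit_density d x * (1 / (z - x))) ?m"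
    using nonneg has_integral_nonneg[OF limit_density_has_integral(2)[OF d z] nonneg]
    by (intro has_bochner_integral_nn_integral) auto
  then show ?thesis
    unfolding limit_measure_def using limit_density_nonneg[OF d]
    by (subst integral_density) (auto simp: has_bochner_integral_iff)
qed

section \<open>Real-rooted polynomials\<close>

lemma map_poly_of_real_mult:
  fixes p q :: "real poly"
  shows "map_poly of_real (p * q) = (map_poly of_real p * map_poly of_real q :: complex poly)"
  by (intro poly_eqI) (simp add: coeff_map_poly coeff_mult)

lemma poly_map_poly_of_real:
  fixes p :: "real poly"
  shows "poly (map_poly of_real p) (of_real x :: complex) = of_real (poly p x)"
  by (induction p) (simp_all add: map_poly_pCons)

lemma real_rooted_poly_factors:
  fixes p :: "real poly"
  assumes "p \<noteq> 0" "\<And>z :: complex. poly (map_poly of_real p) z = 0 \<Longrightarrow> z \<in> \<real>"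
  shows "p = smult (lead_coeff p) (\<Prod>r\<in>#proots p. [:- r, 1:]) \<and> size (proots p) = degree p"
  using assms
proof (induction "degree p" arbitrary: p)
  case 0
  then obtain c where "p = [:c:]" by (metis degree_eq_zeroE)
  then show ?case by simp
next
  case (Suc n)
  have "degree (map_poly complex_of_real p) = degree p" by (rule degree_map_poly) auto
  then obtain z :: complex where z: "poly (map_poly of_real p) z = 0"
    using Suc.hyps(2) fundamental_theorem_of_algebra[of "map_poly of_real p :: complex poly"]
    by (auto simp: constant_degree)
  with Suc.prems obtain x where x: "z = of_real x" by (auto elim: Reals_cases)
  with z have "poly p x = 0" by (simp add: poly_map_poly_of_real)
  then obtain q where q: "p = [:- x, 1:] * q" by (auto simp: poly_eq_0_iff_dvd elim: dvdE)
  with Suc.prems have q0: "q \<noteq> 0" by auto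
  have "n = degree q" using Suc.hyps(2) q0 unfolding q by (subst (asm) degree_mult_eq) auto
  moreover have "z \<in> \<real>" if "poly (map_poly of_real q) z = 0" for z :: complex
    using that by (intro Suc.prems) (simp add: q map_poly_of_real_mult del: mult_pCons_left)
  ultimately have IH: "q = smult (lead_coeff q) (\<Prod>r\<in>#proots q. [:- r, 1:])" "size (proots q) = degree q"
    using Suc.hyps(1)[OF _ q0] by auto
  have roots: "proots p = add_mset x (proots q)"
    unfolding q using q0 by (subst proots_mult) auto
  have lead: "lead_coeff p = lead_coeff q" unfolding q by (subst lead_coeff_mult) simp
  have "degree p = Suc (degree q)" unfolding q using q0 by (subst degree_mult_eq) auto
  then have "size (proots p) = degree p" using roots IH(2) by simp
  moreover have "p = smult (lead_coeff q) ([:- x, 1:] * (\<Prod>r\<in>#proots q. [:- r, 1:]))"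
    unfolding mult_smult_right[symmetric] IH(1)[symmetric] by (rule q)
  then have "p = smult (lead_coeff p) (\<Prod>r\<in>#proots p. [:- r, 1:])"
    unfolding lead roots image_mset_add_mset prod_mset.add_mset .
  ultimately show ?case by simp
qed

lemma poly_pderiv_prod_linear:
  fixes z :: "'a :: field"
  assumes "z \<notin># A"
  shows "poly (pderiv (\<Prod>r\<in>#A. [:- r, 1:])) z =
    poly (\<Prod>r\<in>#A. [:- r, 1:]) z * (\<Sum>r\<in>#A. 1 / (z - r))"
  using assms
  by (induction A) (auto simp: pderiv_mult pderiv_pCons field_simps simp del: mult_pCons_left)

lemma sum_count_eq_sum_mset:
  fixes f :: "'a \<Rightarrow> 'b :: comm_semiring_1"
  assumes "finite B" "set_mset A \<subseteq> B"
  shows "(\<Sum>x\<in>B. of_nat (count A x) * f x) = (\<Sum>x\<in>#A. f x)"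
  using assms(2)
proof (induction A)
  case (add a A)
  have "(\<Sum>x\<in>B. of_nat (count (add_mset a A) x) * f x) =
      (\<Sum>x\<in>B. of_nat (count A x) * f x) + (\<Sum>x\<in>B. if x = a then f x else 0)"
    unfolding sum.distrib[symmetric] by (intro sum.cong) (auto simp: algebra_simps)
  then show ?case using add assms(1) by (auto simp: sum.delta add.commute)
qed simp

lemma integral_pmf_of_multiset:
  fixes f :: "'a \<Rightarrow> real"
  assumes "A \<noteq> {#}"
  shows "(\<integral>x. f x \<partial>measure_pmf (pmf_of_multiset A)) = (\<Sum>x\<in>#A. f x) / size A"
proof -
  have "(\<integral>x. f x \<partial>measure_pmf (pmf_of_multiset A)) = (\<Sum>x\<in>set_mset A. real (count A x) * f x) / size A"
    using assms by (subst integral_measure_pmf_real[of "set_mset A"]) (auto simp: sum_divide_distrib mult.commute)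
  also have "(\<Sum>x\<in>set_mset A. real (count A x) * f x) = (\<Sum>x\<in>#A. f x)"
    by (rule sum_count_eq_sum_mset) auto
  finally show ?thesis .
qed

section \<open>The matching polynomial\<close>

definition matchings_within :: "'a set set \<Rightarrow> 'a set \<Rightarrow> 'a set set set" where
  "matchings_within E V = {M. M \<subseteq> E \<and> disjoint M \<and> \<Union>M \<subseteq> V}"

definition match_sum :: "'a set set \<Rightarrow> 'a set \<Rightarrow> 'b :: comm_ring_1 \<Rightarrow> 'b" where
  "match_sum E V z = (\<Sum>M\<in>matchings_within E V. (- 1) ^ card M * z ^ (card V - 2 * card M))"

definition neighbours :: "'a set set \<Rightarrow> 'a \<Rightarrow> 'a set" where
  "neighbours E v = {u. {v, u} \<in> E}"

lemma neighbours_sym: "u \<in> neighbours E v \<longleftrightarrow> v \<in> neighbours E u"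
  by (simp add: neighbours_def insert_commute)

lemma finite_matchings_within: "finite V \<Longrightarrow> finite (matchings_within E V)"
  by (rule finite_subset[of _ "Pow (Pow V)"]) (auto simp: matchings_within_def)

lemma match_sum_empty [simp]:
  assumes "{} \<notin> E"
  shows "match_sum E {} z = 1"
proof -
  have "matchings_within E {} = {{}}"
    using assms by (auto simp: matchings_within_def disjoint_def)
  then show ?thesis by (simp add: match_sum_def)
qed

locale two_element_edges =
  fixes E :: "'a set set"
  assumes card_edge: "e \<in> E \<Longrightarrow> card e = 2"

lemma (in two_element_edges) neighbours_irrefl: "v \<notin> neighbours E v"
  using card_edge[of "{v}"] by (auto simp: neighbours_def)

lemma (in two_element_edges) empty_not_edge: "{} \<notin> E"
  using card_edge[of "{}"] by auto

lemma (in two_element_edges) card_Union_matching: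
  assumes "M \<in> matchings_within E V" "finite V"
  shows "card (\<Union>M) = 2 * card M" "2 * card M \<le> card V"
proof -
  have M: "M \<subseteq> E" "disjoint M" "\<Union>M \<subseteq> V" using assms by (auto simp: matchings_within_def)
  have "card (\<Union>M) = sum card M"
  proof (rule card_Union_disjoint)
    show "pairwise disjnt M" using M(2) by (auto simp: disjoint_def pairwise_def disjnt_def)
    show "finite A" if "A \<in> M" for A using that M(3) assms(2) by (auto intro: finite_subset)
  qed
  also have "\<dots> = (\<Sum>e\<in>M. 2)" using M(1) card_edge by (intro sum.cong) auto
  finally show eq: "card (\<Union>M) = 2 * card M" by simp
  show "2 * card M \<le> card V" using card_mono[OF assms(2) M(3)] eq by simp
qed

lemma (in two_element_edges) matchings_within_decomp:
  assumes v: "v \<in> V"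
  shows "matchings_within E V = matchings_within E (V - {v}) \<union>
    (\<Union>u\<in>neighbours E v \<inter> V. insert {v, u} ` matchings_within E (V - {v, u}))" (is "_ = ?A \<union> ?B")
proof (intro equalityI subsetI)
  fix M assume M: "M \<in> matchings_within E V"
  show "M \<in> ?A \<union> ?B"
  proof (cases "v \<in> \<Union>M")
    case False
    then show ?thesis using M by (auto simp: matchings_within_def)
  next
    case True
    then obtain e where e: "e \<in> M" "v \<in> e" by auto
    then have "card e = 2" using M card_edge by (auto simp: matchings_within_def)
    then obtain u where u: "e = {v, u}" using e(2) by (auto simp: card_2_iff)
    have "u \<in> neighbours E v \<inter> V" using e u M by (auto simp: matchings_within_def neighbours_def)
    moreover have "M - {e} \<in> matchings_within E (V - {v, u})"
    proof -
      have "f \<inter> e = {}" if "f \<in> M - {e}" for f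
        using that M e(1) by (auto simp: matchings_within_def disjoint_def)
      then have "\<Union>(M - {e}) \<subseteq> V - {v, u}" using M unfolding matchings_within_def u by blast
      then show ?thesis using M by (auto simp: matchings_within_def disjoint_def)
    qed
    moreover have "M = insert {v, u} (M - {e})" using e u by auto
    ultimately show ?thesis by blast
  qed
next
  fix M assume "M \<in> ?A \<union> ?B"
  then show "M \<in> matchings_within E V"
  proof
    assume "M \<in> ?A" then show ?thesis by (auto simp: matchings_within_def)
  next
    assume "M \<in> ?B"
    then obtain u N where uN: "u \<in> neighbours E v" "u \<in> V" "N \<in> matchings_within E (V - {v, u})"
      "M = insert {v, u} N" by auto
    have "disjoint M" unfolding uN(4) using uN(3)
      by (auto simp: disjoint_def matchings_within_def)
    then show ?thesis using uN v by (auto simp: matchings_within_def neighbours_def)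
  qed
qed

lemma (in two_element_edges) match_sum_rec:
  assumes v: "v \<in> V" and fin: "finite V"
  shows "match_sum E V z = z * match_sum E (V - {v}) z - (\<Sum>u\<in>neighbours E v \<inter> V. match_sum E (V - {v, u}) z)"
proof -
  define w where "w M = (- 1) ^ card M * z ^ (card V - 2 * card M)" for M :: "'a set set"
  let ?A = "matchings_within E (V - {v})"
  let ?I = "\<lambda>u. insert {v, u} ` matchings_within E (V - {v, u})"
  have "match_sum E V z = sum w (?A \<union> (\<Union>u\<in>neighbours E v \<inter> V. ?I u))"
    unfolding match_sum_def w_def by (subst matchings_within_decomp[OF v]) simp
  also have "\<dots> = sum w ?A + sum w (\<Union>u\<in>neighbours E v \<inter> V. ?I u)"
  proof (rule sum.union_disjoint)
    show "?A \<inter> (\<Union>u\<in>neighbours E v \<inter> V. ?I u) = {}" by (auto simp: matchings_within_def)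
  qed (use fin in \<open>auto simp: finite_matchings_within\<close>)
  also have "sum w ?A = z * match_sum E (V - {v}) z"
    unfolding match_sum_def sum_distrib_left
  proof (rule sum.cong)
    fix M assume M: "M \<in> ?A"
    have "card V = Suc (card (V - {v}))" using v fin by (metis card.remove)
    moreover have "2 * card M \<le> card (V - {v})" using card_Union_matching(2)[OF M] fin by simp
    ultimately show "w M = z * ((- 1) ^ card M * z ^ (card (V - {v}) - 2 * card M))"
      by (simp add: w_def Suc_diff_le mult_ac)
  qed simp
  also have "sum w (\<Union>u\<in>neighbours E v \<inter> V. ?I u) = (\<Sum>u\<in>neighbours E v \<inter> V. sum w (?I u))"
  proof (rule sum.UNION_disjoint)
    show "\<forall>i\<in>neighbours E v \<inter> V. \<forall>j\<in>neighbours E v \<inter> V. i \<noteq> j \<longrightarrow> ?I i \<inter> ?I j = {}"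
    proof (intro ballI impI equals0I)
      fix i j M assume ij: "i \<noteq> j" "M \<in> ?I i \<inter> ?I j"
      from ij(2) have "{v, i} \<in> M" by auto
      moreover from ij(2) obtain N where N: "M = insert {v, j} N" "N \<in> matchings_within E (V - {v, j})"
        by auto
      ultimately have "{v, i} \<in> insert {v, j} N" by simp
      then have "{v, i} \<in> N" using ij(1) by (auto simp: doubleton_eq_iff)
      then show False using N(2) by (auto simp: matchings_within_def)
    qed
  qed (use fin in \<open>auto simp: finite_matchings_within\<close>)
  also have "\<dots> = (\<Sum>u\<in>neighbours E v \<inter> V. - match_sum E (V - {v, u}) z)"
  proof (rule sum.cong)
    fix u assume u: "u \<in> neighbours E v \<inter> V"
    then have uv: "u \<noteq> v" using neighbours_irrefl by auto
    have cV: "card V = card (V - {v, u}) + 2"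
    proof -
      have "card (V - {v, u}) = card V - 2" using v u uv by (subst card_Diff_subset) auto
      moreover have "card {v, u} \<le> card V" using v u fin by (intro card_mono) auto
      ultimately show ?thesis using uv by simp
    qed
    have nin: "{v, u} \<notin> N" if "N \<in> matchings_within E (V - {v, u})" for N
      using that by (auto simp: matchings_within_def)
    have "sum w (?I u) = (\<Sum>N\<in>matchings_within E (V - {v, u}). w (insert {v, u} N))"
    proof (rule sum.reindex_cong)
      show "inj_on (insert {v, u}) (matchings_within E (V - {v, u}))"
        using nin by (intro inj_onI) (metis insert_ident)
    qed auto
    also have "\<dots> = - match_sum E (V - {v, u}) z"
      unfolding match_sum_def sum_negf[symmetric]
    proof (rule sum.cong)
      fix N assume N: "N \<in> matchings_within E (V - {v, u})"
      have "finite N" using N fin by (auto simp: matchings_within_def intro: finite_subset[of _ "Pow V"])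
      then have "card (insert {v, u} N) = Suc (card N)" using nin[OF N] by simp
      then show "w (insert {v, u} N) = - ((- 1) ^ card N * z ^ (card (V - {v, u}) - 2 * card N))"
        using cV by (simp add: w_def)
    qed simp
    finally show "sum w (?I u) = - match_sum E (V - {v, u}) z" .
  qed simp
  finally show ?thesis by (simp add: sum_negf)
qed

lemma monom_neg_one_power: "(- 1) ^ c * [:0, 1:] ^ k = (monom ((- 1) ^ c) k :: 'a :: comm_ring_1 poly)"
  by (cases "even c") (simp_all add: monom_altdef)

lemma match_sum_poly_eq:
  "match_sum E V [:0, 1 :: 'a :: comm_ring_1:] =
    (\<Sum>M\<in>matchings_within E V. monom ((- 1) ^ card M) (card V - 2 * card M))"
  unfolding match_sum_def by (intro sum.cong refl) (rule monom_neg_one_power)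

lemma poly_match_sum: "poly (match_sum E V [:0, 1:]) z = match_sum E V z"
  by (simp add: match_sum_def poly_sum)

lemma poly_map_match_sum:
  fixes z :: complex
  shows "poly (map_poly of_real (match_sum E V [:0, 1:])) z = match_sum E V z"
proof -
  have "map_poly of_real (match_sum E V [:0, 1:]) = (match_sum E V [:0, 1:] :: complex poly)"
    by (intro poly_eqI) (simp add: match_sum_poly_eq coeff_map_poly coeff_sum if_distrib cong: if_cong)
  then show ?thesis by (simp add: poly_match_sum)
qed

lemma matching_poly_eq_match_sum:
  assumes "finite_graph G"
  shows "matching_poly G = match_sum (edges G) (verts G) [:0, 1:]"
proof -
  let ?n = "card (verts G)"
  have fin: "finite (verts G)" and E: "edges G \<subseteq> {e. e \<subseteq> verts G \<and> card e = 2}"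
    using assms by (auto simp: finite_graph_def)
  interpret two_element_edges "edges G" by standard (use E in auto)
  have part: "{M \<in> matchings_within (edges G) (verts G). card M = k} = matchings G k" for k
    using E by (auto simp: matchings_within_def matchings_def)
  have "card M \<le> ?n div 2" if "M \<in> matchings_within (edges G) (verts G)" for M
    using card_Union_matching(2)[OF that fin] by simp
  then have "match_sum (edges G) (verts G) [:0, 1:] =
      (\<Sum>k\<le>?n div 2. \<Sum>M\<in>matchings G k. monom ((- 1) ^ card M) (?n - 2 * card M))"
    unfolding match_sum_poly_eq part[symmetric]
    using fin by (intro sum.group[symmetric]) (auto simp: finite_matchings_within)
  also have "\<dots> = (\<Sum>k\<le>?n div 2. of_nat (card (matchings G k)) * monom ((- 1) ^ k) (?n - 2 * k))"
    by (intro sum.cong refl) (simp add: matchings_def)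
  also have "\<dots> = matching_poly G"
    unfolding matching_poly_def num_verts_def
    by (intro sum.cong refl) (simp add: of_nat_poly smult_monom mult.commute)
  finally show ?thesis ..
qed

lemma (in two_element_edges) degree_match_sum:
  assumes "finite V"
  shows "degree (match_sum E V [:0, 1 :: 'b :: comm_ring_1:]) = card V"
    "match_sum E V [:0, 1 :: 'b:] \<noteq> 0"
proof -
  let ?p = "match_sum E V [:0, 1 :: 'b:]"
  have empty: "{} \<in> matchings_within E V" by (simp add: matchings_within_def disjoint_def)
  have "coeff ?p (card V) = (\<Sum>M\<in>matchings_within E V. if M = {} then 1 else 0)"
    unfolding match_sum_poly_eq coeff_sum
  proof (rule sum.cong)
    fix M assume M: "M \<in> matchings_within E V"
    have "finite M" using M assms by (auto simp: matchings_within_def intro: finite_subset[of _ "Pow V"])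
    moreover have "card V - 2 * card M = card V \<longleftrightarrow> card M = 0"
      using card_Union_matching(2)[OF M assms] by linarith
    ultimately have "card V - 2 * card M = card V \<longleftrightarrow> M = {}" by simp
    then show "coeff (monom ((- 1) ^ card M) (card V - 2 * card M)) (card V) = (if M = {} then 1 :: 'b else 0)"
      by auto
  qed simp
  also have "\<dots> = 1" using empty by (simp add: finite_matchings_within[OF assms] sum.delta)
  finally have c: "coeff ?p (card V) = 1" .
  then show "?p \<noteq> 0" by auto
  have "degree ?p \<le> card V"
    unfolding match_sum_poly_eq
    by (intro degree_sum_le finite_matchings_within assms order.trans[OF degree_monom_le]) auto
  moreover have "card V \<le> degree ?p" using c by (intro le_degree) auto
  ultimately show "degree ?p = card V" by simp
qed

lemma (in two_element_edges) poly_pderiv_match_sum: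
  fixes z :: real
  assumes fin: "finite V"
  shows "poly (pderiv (match_sum E V [:0, 1:])) z = (\<Sum>v\<in>V. match_sum E (V - {v}) z)"
proof -
  let ?w = "\<lambda>M. (- 1) ^ card M * z ^ (card V - 1 - 2 * card M)"
  have "(\<Sum>v\<in>V. match_sum E (V - {v}) z) = (\<Sum>v\<in>V. \<Sum>M | M \<in> matchings_within E V \<and> v \<notin> \<Union>M. ?w M)"
  proof (rule sum.cong)
    fix v assume "v \<in> V"
    then have "matchings_within E (V - {v}) = {M. M \<in> matchings_within E V \<and> v \<notin> \<Union>M}" "card (V - {v}) = card V - 1"
      using fin by (auto simp: matchings_within_def)
    then show "match_sum E (V - {v}) z = (\<Sum>M | M \<in> matchings_within E V \<and> v \<notin> \<Union>M. ?w M)"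
      by (simp add: match_sum_def)
  qed simp
  also have "\<dots> = (\<Sum>M\<in>matchings_within E V. \<Sum>v | v \<in> V \<and> v \<notin> \<Union>M. ?w M)"
    using fin by (intro sum.swap_restrict finite_matchings_within)
  also have "\<dots> = (\<Sum>M\<in>matchings_within E V. real (card V - 2 * card M) * ?w M)"
  proof (rule sum.cong)
    fix M assume M: "M \<in> matchings_within E V"
    then have sub: "\<Union>M \<subseteq> V" by (simp add: matchings_within_def)
    have "{v. v \<in> V \<and> v \<notin> \<Union>M} = V - \<Union>M" by auto
    then have "card {v. v \<in> V \<and> v \<notin> \<Union>M} = card V - 2 * card M"
      using card_Diff_subset[OF finite_subset[OF sub fin] sub] card_Union_matching(1)[OF M fin] by simp
    then show "(\<Sum>v | v \<in> V \<and> v \<notin> \<Union>M. ?w M) = real (card V - 2 * card M) * ?w M" by simp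
  qed simp
  also have "\<dots> = poly (pderiv (match_sum E V [:0, 1:])) z"
  proof -
    have "pderiv (sum f A) = (\<Sum>a\<in>A. pderiv (f a))" for f :: "'a set set \<Rightarrow> real poly" and A
      by (induction A rule: infinite_finite_induct) (simp_all add: pderiv_add)
    then show ?thesis by (simp add: match_sum_poly_eq pderiv_monom poly_sum poly_monom mult_ac diff_diff_eq)
  qed
  finally show ?thesis ..
qed

definition match_ratio :: "'a set set \<Rightarrow> 'a set \<Rightarrow> 'a \<Rightarrow> 'b :: field \<Rightarrow> 'b" where
  "match_ratio E V v z = match_sum E (V - {v}) z / match_sum E V z"

lemma (in two_element_edges) match_sum_continued_fraction:
  fixes z :: "'b :: field"
  assumes v: "v \<in> V" and fin: "finite V" and nz: "match_sum E (V - {v}) z \<noteq> 0"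
  shows "match_sum E V z = match_sum E (V - {v}) z *
    (z - (\<Sum>u\<in>neighbours E v \<inter> V. match_ratio E (V - {v}) u z))"
proof -
  have "V - {v, u} = V - {v} - {u}" for u by auto
  then show ?thesis
    unfolding match_sum_rec[OF v fin] match_ratio_def
    using nz by (simp add: algebra_simps sum_distrib_left)
qed

lemma (in two_element_edges) match_ratio_rec:
  fixes z :: "'b :: field"
  assumes v: "v \<in> V" and fin: "finite V" and nz: "match_sum E (V - {v}) z \<noteq> 0"
  shows "match_ratio E V v z = 1 / (z - (\<Sum>u\<in>neighbours E v \<inter> V. match_ratio E (V - {v}) u z))"
  using match_sum_continued_fraction[OF assms] nz by (simp add: match_ratio_def)

text \<open>Heilmann--Lieb: in the continued fraction for the ratios, Im z > 0 forces negative
  imaginary parts, so no denominator vanishes.\<close>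

lemma (in two_element_edges) match_sum_upper_half_plane:
  fixes z :: complex
  assumes "finite V" and z: "Im z > 0"
  shows "match_sum E V z \<noteq> 0 \<and> (\<forall>v\<in>V. Im (match_ratio E V v z) < 0)"
  using assms(1)
proof (induction V rule: finite_psubset_induct)
  case (psubset V)
  have step: "match_sum E V z \<noteq> 0 \<and> Im (match_ratio E V v z) < 0" if v: "v \<in> V" for v
  proof -
    define S where "S = (\<Sum>u\<in>neighbours E v \<inter> V. match_ratio E (V - {v}) u z)"
    have IH: "match_sum E (V - {v}) z \<noteq> 0" "\<And>u. u \<in> V - {v} \<Longrightarrow> Im (match_ratio E (V - {v}) u z) < 0"
      using psubset.IH[of "V - {v}"] v by auto
    have "Im S \<le> 0"
      unfolding S_def Im_sum using IH(2) neighbours_irrefl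
      by (intro sum_nonpos less_imp_le) auto
    then have im: "Im (z - S) > 0" using z by simp
    then have "z - S \<noteq> 0" by auto
    moreover have "Im (1 / (z - S)) < 0"
    proof -
      have "(Re (z - S))\<^sup>2 + (Im (z - S))\<^sup>2 > 0" using im by (intro add_nonneg_pos) auto
      then show ?thesis using im by (simp add: Im_divide divide_neg_pos del: minus_complex.sel)
    qed
    ultimately show ?thesis
      using match_sum_continued_fraction[OF v psubset.hyps IH(1)] match_ratio_rec[OF v psubset.hyps IH(1)] IH(1)
      unfolding S_def[symmetric] by simp
  qed
  show ?case
  proof (cases "V = {}")
    case True
    then show ?thesis using empty_not_edge by simp
  next
    case False
    then show ?thesis using step by auto
  qed
qed

lemma (in two_element_edges) match_sum_complex_root_real:
  fixes z :: complex
  assumes "finite V" "match_sum E V z = 0"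
  shows "z \<in> \<real>"
proof (rule ccontr)
  assume "z \<notin> \<real>"
  then have "Im z > 0 \<or> Im (cnj z) > 0" by (auto simp: complex_is_Real_iff)
  moreover have "match_sum E V (cnj z) = cnj (match_sum E V z)" by (simp add: match_sum_def)
  ultimately show False using match_sum_upper_half_plane[OF assms(1)] assms(2) by (metis complex_cnj_zero)
qed

lemma (in two_element_edges) match_sum_large_argument:
  fixes z :: real
  assumes "finite V" and d: "d > 0" and z: "\<bar>z\<bar> \<ge> 2 * real d"
    and deg: "\<And>v. finite (neighbours E v)" "\<And>v. card (neighbours E v) \<le> d"
  shows "match_sum E V z \<noteq> 0 \<and> (\<forall>v\<in>V. \<bar>match_ratio E V v z\<bar> \<le> 1 / real d)"
  using assms(1)
proof (induction V rule: finite_psubset_induct)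
  case (psubset V)
  have step: "match_sum E V z \<noteq> 0 \<and> \<bar>match_ratio E V v z\<bar> \<le> 1 / real d" if v: "v \<in> V" for v
  proof -
    define S where "S = (\<Sum>u\<in>neighbours E v \<inter> V. match_ratio E (V - {v}) u z)"
    have IH: "match_sum E (V - {v}) z \<noteq> 0" "\<And>u. u \<in> V - {v} \<Longrightarrow> \<bar>match_ratio E (V - {v}) u z\<bar> \<le> 1 / real d"
      using psubset.IH[of "V - {v}"] v by auto
    have "\<bar>S\<bar> \<le> (\<Sum>u\<in>neighbours E v \<inter> V. 1 / real d)"
      unfolding S_def using IH(2) neighbours_irrefl by (intro order.trans[OF sum_abs] sum_mono) auto
    also have "\<dots> = real (card (neighbours E v \<inter> V)) / real d" by simp
    also have "card (neighbours E v \<inter> V) \<le> d"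
      using deg by (meson card_mono inf_le1 order.trans)
    then have "real (card (neighbours E v \<inter> V)) / real d \<le> 1" using d by simp
    finally have "\<bar>z - S\<bar> \<ge> real d" using z d by linarith
    then have "z - S \<noteq> 0" "\<bar>1 / (z - S)\<bar> \<le> 1 / real d" using d by (auto simp: frac_le)
    then show ?thesis
      using match_sum_continued_fraction[OF v psubset.hyps IH(1)] match_ratio_rec[OF v psubset.hyps IH(1)] IH(1)
      unfolding S_def[symmetric] by simp
  qed
  show ?case
  proof (cases "V = {}")
    case True
    then show ?thesis using empty_not_edge by simp
  next
    case False
    then show ?thesis using step by auto
  qed
qed

lemma two_element_edges_finite_graph: "finite_graph G \<Longrightarrow> two_element_edges (edges G)"
  by unfold_locales (auto simp: finite_graph_def)

lemma matching_poly_proots: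
  assumes "finite_graph G"
  shows "matching_poly G = smult (lead_coeff (matching_poly G)) (\<Prod>r\<in>#proots (matching_poly G). [:- r, 1:])"
    "size (proots (matching_poly G)) = num_verts G" "proots (matching_poly G) \<noteq> {#}"
    "matching_poly G \<noteq> 0"
proof -
  interpret two_element_edges "edges G" by (rule two_element_edges_finite_graph[OF assms])
  have fin: "finite (verts G)" "verts G \<noteq> {}" using assms by (auto simp: finite_graph_def)
  note eq = matching_poly_eq_match_sum[OF assms]
  show nz: "matching_poly G \<noteq> 0" using degree_match_sum[OF fin(1)] unfolding eq by blast
  have "z \<in> \<real>" if "poly (map_poly of_real (matching_poly G)) z = 0" for z :: complex
    using that match_sum_complex_root_real[OF fin(1)] unfolding eq poly_map_match_sum by blast
  note * = real_rooted_poly_factors[OF nz this]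
  then show "matching_poly G = smult (lead_coeff (matching_poly G)) (\<Prod>r\<in>#proots (matching_poly G). [:- r, 1:])"
    by blast
  have "degree (matching_poly G) = num_verts G"
    unfolding eq num_verts_def by (rule degree_match_sum(1)[OF fin(1)])
  with * show size: "size (proots (matching_poly G)) = num_verts G" by simp
  have "num_verts G \<noteq> 0" using fin by (simp add: num_verts_def)
  then show "proots (matching_poly G) \<noteq> {#}" using size by auto
qed

lemma real_distribution_matching_measure: "real_distribution (matching_measure G)"
  unfolding matching_measure_def real_distribution_def real_distribution_axioms_def
  by (auto intro!: measure_pmf.prob_space_distr)

lemma AE_matching_measure:
  assumes G: "finite_graph G" and d: "d > 0"
    and deg: "\<And>v. finite (neighbours (edges G) v)" "\<And>v. card (neighbours (edges G) v) \<le> d"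
  shows "AE x in matching_measure G. \<bar>x\<bar> \<le> 2 * real d"
proof -
  interpret two_element_edges "edges G" by (rule two_element_edges_finite_graph[OF G])
  have fin: "finite (verts G)" using G by (auto simp: finite_graph_def)
  have "\<bar>x\<bar> \<le> 2 * real d" if "x \<in># proots (matching_poly G)" for x
  proof (rule ccontr)
    assume "\<not> \<bar>x\<bar> \<le> 2 * real d"
    then have "poly (matching_poly G) x \<noteq> 0"
      unfolding matching_poly_eq_match_sum[OF G] poly_match_sum
      using match_sum_large_argument[OF fin d _ deg, of x] by auto
    then show False using that matching_poly_proots(4)[OF G] by simp
  qed
  then show ?thesis
    unfolding matching_measure_def using matching_poly_proots(3)[OF G]
    by (subst AE_distr_iff) (auto simp: AE_measure_pmf_iff)
qed

lemma stieltjes_matching_measure: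
  assumes G: "finite_graph G" and z: "match_sum (edges G) (verts G) z \<noteq> 0"
  shows "(\<integral>x. 1 / (z - x) \<partial>matching_measure G) =
    (\<Sum>v\<in>verts G. match_ratio (edges G) (verts G) v z) / num_verts G"
proof -
  interpret two_element_edges "edges G" by (rule two_element_edges_finite_graph[OF G])
  have fin: "finite (verts G)" using G by (auto simp: finite_graph_def)
  let ?p = "matching_poly G" and ?A = "proots (matching_poly G)"
  have pz: "poly ?p z = match_sum (edges G) (verts G) z"
    unfolding matching_poly_eq_match_sum[OF G] by (rule poly_match_sum)
  have zA: "z \<notin># ?A" using z pz matching_poly_proots(4)[OF G] by simp
  have "poly (pderiv ?p) z = poly ?p z * (\<Sum>r\<in>#?A. 1 / (z - r))"
    by (subst (1 2) matching_poly_proots(1)[OF G])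
      (simp only: pderiv_smult poly_smult poly_pderiv_prod_linear[OF zA] mult.assoc)
  then have "(\<Sum>r\<in>#?A. 1 / (z - r)) = poly (pderiv ?p) z / poly ?p z" using z pz by simp
  also have "\<dots> = (\<Sum>v\<in>verts G. match_ratio (edges G) (verts G) v z)"
    unfolding pz unfolding matching_poly_eq_match_sum[OF G] poly_pderiv_match_sum[OF fin]
    by (simp add: match_ratio_def sum_divide_distrib)
  finally have sum: "(\<Sum>r\<in>#?A. 1 / (z - r)) = (\<Sum>v\<in>verts G. match_ratio (edges G) (verts G) v z)" .
  have "(\<integral>x. 1 / (z - x) \<partial>matching_measure G) = (\<integral>x. 1 / (z - x) \<partial>measure_pmf (pmf_of_multiset ?A))"
    unfolding matching_measure_def by (rule integral_distr) auto
  also have "\<dots> = (\<Sum>r\<in>#?A. 1 / (z - r)) / size ?A"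
    by (rule integral_pmf_of_multiset[OF matching_poly_proots(3)[OF G]])
  finally show ?thesis unfolding sum matching_poly_proots(2)[OF G] .
qed

section \<open>Comparison with the regular tree\<close>

text \<open>The fixed point of the continued fraction on the infinite tree in which every vertex has
  \<open>d - 1\<close> children: the value that the ratio takes at a non-root vertex of the \<open>d\<close>-regular tree.\<close>

definition tree_ratio :: "nat \<Rightarrow> real \<Rightarrow> real" where
  "tree_ratio d z = (z - sqrt (z\<^sup>2 - 4 * (real d - 1))) / (2 * (real d - 1))"

lemma tree_ratio_props:
  assumes d: "d \<ge> 2" and z: "z \<ge> 2 * real d"
  shows "tree_ratio d z = 1 / (z - (real d - 1) * tree_ratio d z)"
    "0 < tree_ratio d z" "tree_ratio d z \<le> 1 / real d"
    "z - (real d - 1) * tree_ratio d z \<noteq> 0"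
    "z - real d * tree_ratio d z \<ge> real d"
    "1 / (z - real d * tree_ratio d z) =
      ((2 - real d) * z + real d * sqrt (z\<^sup>2 - 4 * (real d - 1))) / (2 * (z\<^sup>2 - (real d)\<^sup>2))"
proof -
  define q where "q = real d - 1"
  define s where "s = sqrt (z\<^sup>2 - 4 * q)"
  define T where "T = tree_ratio d z"
  have q: "q \<ge> 1" "real d = q + 1" using d by (auto simp: q_def)
  have "(real d)\<^sup>2 < z\<^sup>2" using d z by (intro power_strict_mono) auto
  moreover have "4 * q \<le> (real d)\<^sup>2"
    using zero_le_power2[of "q - 1"] unfolding q(2) by (simp add: power2_eq_square algebra_simps)
  ultimately have s: "s \<ge> 0" "s\<^sup>2 = z\<^sup>2 - 4 * q" and zd: "(real d)\<^sup>2 < z\<^sup>2" unfolding s_def by auto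
  have z0: "z > 0" using d z by simp
  have T: "T = (z - s) / (2 * q)" by (simp add: T_def tree_ratio_def q_def s_def)
  have qT: "q * T = (z - s) / 2" using q by (simp add: T field_simps)
  have T2: "T = 2 / (z + s)"
  proof -
    have "(z - s) * (z + s) = 4 * q" using s(2) by (simp add: power2_eq_square algebra_simps)
    then show ?thesis using q z0 s(1) by (simp add: T field_simps)
  qed
  have zqT: "z - q * T = (z + s) / 2" unfolding qT by (simp add: field_simps)
  show "tree_ratio d z = 1 / (z - (real d - 1) * tree_ratio d z)"
    unfolding T_def[symmetric] q_def[symmetric] zqT using T2 by simp
  show "z - (real d - 1) * tree_ratio d z \<noteq> 0"
    unfolding T_def[symmetric] q_def[symmetric] zqT using z0 s(1) by simp
  show T0: "0 < tree_ratio d z" unfolding T_def[symmetric] T2 using z0 s(1) by simp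
  have "T \<le> 2 / z" unfolding T2 using z0 s(1) by (intro divide_left_mono) auto
  also have "\<dots> \<le> 2 / (2 * real d)" using z d by (intro divide_left_mono) auto
  finally show T1: "tree_ratio d z \<le> 1 / real d" by (simp add: T_def)
  then have "real d * T \<le> 1" using d by (simp add: T_def field_simps)
  then show dT: "z - real d * tree_ratio d z \<ge> real d" unfolding T_def[symmetric] using z d by simp
  have "2 * q * (z - real d * T) = 2 * q * z - real d * (2 * (q * T))" by (simp add: algebra_simps)
  also have "2 * (q * T) = z - s" using qT by simp
  also have "2 * q * z - real d * (z - s) = (real d - 2) * z + real d * s"
    unfolding q(2) by (simp add: algebra_simps)
  finally have A: "2 * q * (z - real d * T) = (real d - 2) * z + real d * s" .
  have "2 * q * ((z - real d * T) * ((2 - real d) * z + real d * s)) =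
      2 * q * (z - real d * T) * ((2 - real d) * z + real d * s)" by (rule mult.assoc[symmetric])
  also have "\<dots> = (real d * s)\<^sup>2 - ((real d - 2) * z)\<^sup>2" unfolding A by algebra
  also have "\<dots> = 2 * q * (2 * (z\<^sup>2 - (real d)\<^sup>2))"
    unfolding power_mult_distrib s(2) q(2) by (simp add: power2_eq_square algebra_simps)
  finally have "(z - real d * T) * ((2 - real d) * z + real d * s) = 2 * (z\<^sup>2 - (real d)\<^sup>2)" using q by simp
  moreover have "z - real d * T > 0" using dT d by (simp add: T_def)
  ultimately have "1 / (z - real d * T) = ((2 - real d) * z + real d * s) / (2 * (z\<^sup>2 - (real d)\<^sup>2))"
    using zd by (simp add: field_simps)
  then show "1 / (z - real d * tree_ratio d z) =
      ((2 - real d) * z + real d * sqrt (z\<^sup>2 - 4 * (real d - 1))) / (2 * (z\<^sup>2 - (real d)\<^sup>2))"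
    by (simp add: T_def s_def q_def)
qed

text \<open>Paths are listed backwards: \<open>v\<close> is the starting point and the head is the current end.\<close>

definition path_from :: "'a set set \<Rightarrow> 'a \<Rightarrow> 'a list \<Rightarrow> bool" where
  "path_from E v xs \<longleftrightarrow> xs \<noteq> [] \<and> distinct xs \<and> last xs = v \<and> successively (\<lambda>x y. y \<in> neighbours E x) xs"

definition locally_tree :: "'a set set \<Rightarrow> nat \<Rightarrow> 'a \<Rightarrow> bool" where
  "locally_tree E k v \<longleftrightarrow>
    (\<forall>x y ys. path_from E v (x # y # ys) \<longrightarrow> length ys < k \<longrightarrow> neighbours E x \<inter> set ys = {})"

lemma abs_inverse_diff_le:
  fixes a b c :: real
  assumes "a \<noteq> 0" "b \<noteq> 0" "c \<ge> 0" "\<bar>1 / a\<bar> \<le> c" "\<bar>1 / b\<bar> \<le> c"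
  shows "\<bar>1 / a - 1 / b\<bar> \<le> c * c * \<bar>b - a\<bar>"
proof -
  have "1 / a - 1 / b = (1 / a) * (1 / b) * (b - a)" using assms by (simp add: field_simps)
  then have "\<bar>1 / a - 1 / b\<bar> = \<bar>1 / a\<bar> * \<bar>1 / b\<bar> * \<bar>b - a\<bar>" by (metis abs_mult)
  also have "\<dots> \<le> c * c * \<bar>b - a\<bar>" using assms by (intro mult_mono) auto
  finally show ?thesis .
qed

lemma (in two_element_edges) match_ratio_near_tree_step:
  fixes z :: real
  assumes fin: "finite V" and d: "d > 0" and z: "\<bar>z\<bar> \<ge> 2 * real d"
    and deg: "\<And>v. finite (neighbours E v)" "\<And>v. card (neighbours E v) \<le> d"
    and v: "v \<in> V" and card: "card (neighbours E v \<inter> V) = c"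
    and T: "z - real c * T \<noteq> 0" "\<bar>1 / (z - real c * T)\<bar> \<le> 1 / real d"
    and near: "\<And>u. u \<in> neighbours E v \<inter> V \<Longrightarrow> \<bar>match_ratio E (V - {v}) u z - T\<bar> \<le> e"
  shows "\<bar>match_ratio E V v z - 1 / (z - real c * T)\<bar> \<le> real c / (real d)\<^sup>2 * e"
proof -
  define S where "S = (\<Sum>u\<in>neighbours E v \<inter> V. match_ratio E (V - {v}) u z)"
  have nz: "match_sum E (V - {v}) z \<noteq> 0" "match_sum E V z \<noteq> 0" "\<bar>match_ratio E V v z\<bar> \<le> 1 / real d"
    using match_sum_large_argument[OF _ d z deg] fin v by auto
  have R: "match_ratio E V v z = 1 / (z - S)"
    unfolding S_def by (rule match_ratio_rec[OF v fin nz(1)])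
  have zS: "z - S \<noteq> 0"
    using match_sum_continued_fraction[OF v fin nz(1)] nz(2) unfolding S_def by auto
  have "S - real c * T = (\<Sum>u\<in>neighbours E v \<inter> V. match_ratio E (V - {v}) u z - T)"
    by (simp add: S_def sum_subtractf card)
  then have "\<bar>S - real c * T\<bar> \<le> (\<Sum>u\<in>neighbours E v \<inter> V. \<bar>match_ratio E (V - {v}) u z - T\<bar>)"
    by (simp only: sum_abs)
  also have "\<dots> \<le> (\<Sum>u\<in>neighbours E v \<inter> V. e)" by (rule sum_mono[OF near])
  finally have "\<bar>S - real c * T\<bar> \<le> (\<Sum>u\<in>neighbours E v \<inter> V. e)" .
  then have S: "\<bar>S - real c * T\<bar> \<le> real c * e" by (simp add: card)
  have "\<bar>1 / (z - S) - 1 / (z - real c * T)\<bar> \<le> 1 / real d * (1 / real d) * \<bar>z - real c * T - (z - S)\<bar>"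
    using zS T nz(3) unfolding R by (intro abs_inverse_diff_le) auto
  also have "\<dots> \<le> 1 / real d * (1 / real d) * (real c * e)"
    using S by (intro mult_left_mono) auto
  finally show ?thesis unfolding R by (simp add: power2_eq_square)
qed

lemma (in two_element_edges) match_ratio_along_path:
  fixes z :: real
  assumes fin: "finite W" and d: "d \<ge> 2" and z: "z \<ge> 2 * real d"
    and deg: "\<And>v. finite (neighbours E v)" "\<And>v. card (neighbours E v) \<le> d"
    and reg: "\<And>v. v \<in> W \<Longrightarrow> neighbours E v \<subseteq> W \<and> card (neighbours E v) = d"
    and tree: "locally_tree E k v"
    and path: "path_from E v (x # y # ys)" "set (x # y # ys) \<subseteq> W" "length ys + r \<le> k"
  shows "\<bar>match_ratio E (W - set (y # ys)) x z - tree_ratio d z\<bar> \<le> 2 / real d * (1 / real d) ^ r"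
  using path
proof (induction r arbitrary: x y ys)
  case 0
  have "\<bar>match_ratio E (W - set (y # ys)) x z\<bar> \<le> 1 / real d"
    using match_sum_large_argument[of "W - set (y # ys)" d z] fin d z deg 0 by (auto simp: path_from_def)
  then show ?case using tree_ratio_props(2,3)[OF d z] by simp
next
  case (Suc r)
  define V where "V = W - set (y # ys)"
  have xV: "x \<in> V" using Suc.prems by (auto simp: V_def path_from_def)
  have xW: "x \<in> W" using Suc.prems by auto
  have "neighbours E x \<inter> set ys = {}"
    using tree Suc.prems unfolding locally_tree_def by simp
  then have nb: "neighbours E x \<inter> V = neighbours E x - {y}"
    using reg[OF xW] by (auto simp: V_def)
  have y: "y \<in> neighbours E x" using Suc.prems(1) by (simp add: path_from_def)
  then have card: "card (neighbours E x \<inter> V) = d - 1"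
    unfolding nb using reg[OF xW] deg(1) by simp
  have Vx: "V - {x} = W - set (x # y # ys)" by (auto simp: V_def)
  have near: "\<bar>match_ratio E (V - {x}) u z - tree_ratio d z\<bar> \<le> 2 / real d * (1 / real d) ^ r"
    if u: "u \<in> neighbours E x \<inter> V" for u
    unfolding Vx
  proof (rule Suc.IH)
    show "path_from E v (u # x # y # ys)"
      using Suc.prems(1) u neighbours_irrefl[of x] neighbours_sym[of x E u] by (auto simp: path_from_def V_def)
    show "set (u # x # y # ys) \<subseteq> W" using Suc.prems(2) u by (auto simp: V_def)
    show "length (y # ys) + r \<le> k" using Suc.prems(3) by simp
  qed
  have dd: "real (d - 1) = real d - 1" using d by simp
  have "\<bar>match_ratio E V x z - 1 / (z - real (d - 1) * tree_ratio d z)\<bar> \<le>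
      real (d - 1) / (real d)\<^sup>2 * (2 / real d * (1 / real d) ^ r)"
  proof (rule match_ratio_near_tree_step[OF _ _ _ deg xV card _ _ near])
    show "z - real (d - 1) * tree_ratio d z \<noteq> 0" unfolding dd by (rule tree_ratio_props(4)[OF d z])
    show "\<bar>1 / (z - real (d - 1) * tree_ratio d z)\<bar> \<le> 1 / real d"
      unfolding dd tree_ratio_props(1)[OF d z, symmetric] using tree_ratio_props(2,3)[OF d z] by simp
  qed (use fin d z in \<open>auto simp: V_def\<close>)
  also have "\<dots> \<le> 1 / real d * (2 / real d * (1 / real d) ^ r)"
    using d by (intro mult_right_mono) (auto simp: power2_eq_square field_simps)
  also have "1 / (z - real (d - 1) * tree_ratio d z) = tree_ratio d z"
    unfolding dd by (rule tree_ratio_props(1)[OF d z, symmetric])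
  finally show ?case by (simp add: V_def)
qed

lemma (in two_element_edges) match_ratio_locally_tree:
  fixes z :: real
  assumes fin: "finite W" and d: "d \<ge> 2" and z: "z \<ge> 2 * real d"
    and deg: "\<And>v. finite (neighbours E v)" "\<And>v. card (neighbours E v) \<le> d"
    and reg: "\<And>v. v \<in> W \<Longrightarrow> neighbours E v \<subseteq> W \<and> card (neighbours E v) = d"
    and tree: "locally_tree E k v" and v: "v \<in> W"
  shows "\<bar>match_ratio E W v z - 1 / (z - real d * tree_ratio d z)\<bar> \<le> (1 / 2) ^ k"
proof -
  have nb: "neighbours E v \<inter> W = neighbours E v" using reg[OF v] by auto
  have near: "\<bar>match_ratio E (W - {v}) u z - tree_ratio d z\<bar> \<le> 2 / real d * (1 / real d) ^ k"
    if u: "u \<in> neighbours E v \<inter> W" for u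
  proof -
    have "path_from E v [u, v]" "set [u, v] \<subseteq> W"
      using u v neighbours_irrefl[of v] neighbours_sym[of v E u] by (auto simp: path_from_def)
    from match_ratio_along_path[OF fin d z deg reg tree this, of k] show ?thesis by simp
  qed
  have pos: "z - real d * tree_ratio d z > 0" using tree_ratio_props(5)[OF d z] d by linarith
  have "\<bar>match_ratio E W v z - 1 / (z - real d * tree_ratio d z)\<bar> \<le>
      real d / (real d)\<^sup>2 * (2 / real d * (1 / real d) ^ k)"
  proof (rule match_ratio_near_tree_step[OF fin _ _ deg v _ _ _ near])
    show "\<bar>1 / (z - real d * tree_ratio d z)\<bar> \<le> 1 / real d"
      using tree_ratio_props(5)[OF d z] pos d by (simp add: frac_le)
  qed (use d z pos nb reg[OF v] in auto)
  also have "\<dots> = 2 / (real d)\<^sup>2 * (1 / real d) ^ k" using d by (simp add: power2_eq_square)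
  also have "\<dots> \<le> 1 * (1 / 2) ^ k"
  proof (intro mult_mono power_mono)
    have "2 * 2 \<le> real d * real d" using d by (intro mult_mono) auto
    then show "2 / (real d)\<^sup>2 \<le> 1" using d by (simp add: power2_eq_square)
  qed (use d in \<open>auto simp: field_simps\<close>)
  finally show ?thesis by simp
qed

primrec nb_ball :: "'a set set \<Rightarrow> nat \<Rightarrow> 'a \<Rightarrow> 'a set" where
  "nb_ball E 0 u = {u}"
| "nb_ball E (Suc j) u = insert u (\<Union>y\<in>neighbours E u. nb_ball E j y)"

lemma nb_ball_finite_card:
  assumes deg: "\<And>v. finite (neighbours E v)" "\<And>v. card (neighbours E v) \<le> d"
  shows "finite (nb_ball E j u) \<and> card (nb_ball E j u) \<le> Suc d ^ j"
proof (induction j arbitrary: u)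
  case (Suc j)
  have "card (nb_ball E (Suc j) u) \<le> Suc (card (\<Union>y\<in>neighbours E u. nb_ball E j y))"
    by (simp add: card_insert_le_m1 card_insert_if)
  also have "card (\<Union>y\<in>neighbours E u. nb_ball E j y) \<le> (\<Sum>y\<in>neighbours E u. card (nb_ball E j y))"
    by (rule card_UN_le[OF deg(1)])
  also have "\<dots> \<le> (\<Sum>y\<in>neighbours E u. Suc d ^ j)" using Suc by (intro sum_mono) auto
  also have "\<dots> \<le> d * Suc d ^ j" using deg(2)[of u] by simp
  also have "Suc (d * Suc d ^ j) \<le> Suc d ^ Suc j" by (simp add: Suc_leI)
  finally show ?case using Suc deg(1) by simp
qed simp

lemma last_in_nb_ball:
  assumes "successively (\<lambda>x y. y \<in> neighbours E x) (u # bs)" "length bs \<le> j"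
  shows "last (u # bs) \<in> nb_ball E j u"
  using assms
proof (induction bs arbitrary: u j)
  case Nil
  then show ?case by (cases j) auto
next
  case (Cons b bs)
  then obtain i where j: "j = Suc i" by (cases j) auto
  have "last (b # bs) \<in> nb_ball E i b" using Cons.prems by (intro Cons.IH) (auto simp: j)
  then show ?case using Cons.prems(1) by (auto simp: j)
qed

lemma not_locally_tree_near_cycle:
  assumes "\<not> locally_tree (edges G) k v"
  obtains L C u where "3 \<le> L" "L \<le> Suc k" "C \<in> cycles G L" "u \<in> \<Union>C" "v \<in> nb_ball (edges G) k u"
proof -
  let ?adj = "\<lambda>x y. y \<in> neighbours (edges G) x"
  obtain x y ys u where path: "path_from (edges G) v (x # y # ys)" "length ys < k"
    and u: "u \<in> neighbours (edges G) x" "u \<in> set ys"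
    using assms unfolding locally_tree_def by blast
  obtain as bs where ys: "ys = as @ u # bs" using u(2) by (metis split_list)
  define cs where "cs = x # y # as @ [u]"
  define L where "L = length cs"
  define C where "C = {{cs ! i, cs ! (Suc i mod L)} |i. i < L}"
  have split: "x # y # ys = (x # y # as) @ u # bs" "x # y # ys = cs @ bs" by (simp_all add: ys cs_def)
  have succ: "successively ?adj (u # bs)" "successively ?adj cs"
    using path(1) unfolding path_from_def split(1) successively_append_iff
    using path(1) unfolding path_from_def split(2) successively_append_iff by auto
  have L: "3 \<le> L" "L \<le> Suc k" using path(2) by (auto simp: L_def cs_def ys)
  have "C \<subseteq> edges G"
  proof
    fix e assume "e \<in> C"
    then obtain i where i: "i < L" "e = {cs ! i, cs ! (Suc i mod L)}" by (auto simp: C_def)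
    show "e \<in> edges G"
    proof (cases "Suc i = L")
      case True
      then have "cs ! i = last cs" by (metis L_def diff_Suc_1 last_conv_nth length_0_conv nat.simps(3))
      then show ?thesis using u(1) True i(2) by (simp add: neighbours_def cs_def insert_commute)
    next
      case False
      then have "Suc i < length cs" using i(1) by (simp add: L_def)
      then show ?thesis
        using succ(2) i(2) False by (auto simp: successively_conv_nth neighbours_def L_def)
    qed
  qed
  moreover have "distinct cs" using path(1) by (auto simp: path_from_def ys cs_def)
  ultimately have "C \<in> cycles G L" unfolding cycles_def C_def L_def by blast
  moreover have "u \<in> \<Union>C"
  proof -
    have "{cs ! (L - 1), cs ! (Suc (L - 1) mod L)} \<in> C" unfolding C_def using L by force
    moreover have "cs ! (L - 1) = u" by (simp add: L_def cs_def)
    ultimately show ?thesis by auto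
  qed
  moreover have "v \<in> nb_ball (edges G) k u"
  proof -
    have "last (u # bs) = v" using path(1) by (simp add: path_from_def ys)
    then show ?thesis using last_in_nb_ball[OF succ(1), of k] path(2) by (simp add: ys)
  qed
  ultimately show thesis using L that by blast
qed

lemma cycles_finite_card:
  assumes "C \<in> cycles G L" "L > 0"
  shows "finite (\<Union>C)" "card (\<Union>C) \<le> L"
proof -
  obtain xs where xs: "distinct xs" "length xs = L" "C = {{xs ! i, xs ! (Suc i mod L)} |i. i < L}"
    using assms by (auto simp: cycles_def)
  have "\<Union>C \<subseteq> set xs" unfolding xs(3) using assms(2) xs(2) by auto
  then show "finite (\<Union>C)" "card (\<Union>C) \<le> L"
    using xs card_mono[of "set xs" "\<Union>C"] by (auto simp: distinct_card intro: finite_subset)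
qed

lemma card_not_locally_tree:
  assumes G: "finite_graph G"
    and deg: "\<And>v. finite (neighbours (edges G) v)" "\<And>v. card (neighbours (edges G) v) \<le> d"
  shows "card {v \<in> verts G. \<not> locally_tree (edges G) k v} \<le>
    (\<Sum>L\<in>{3..Suc k}. card (cycles G L) * (L * Suc d ^ k))"
proof -
  have "finite (edges G)"
    using G by (auto simp: finite_graph_def intro!: finite_subset[of "edges G" "Pow (verts G)"])
  then have fin_cycles: "finite (cycles G L)" for L
    by (rule finite_subset[rotated, OF finite_Pow_iff[THEN iffD2]]) (auto simp: cycles_def)
  define B where "B C = (\<Union>u\<in>\<Union>C. nb_ball (edges G) k u)" for C
  have B_bound: "finite (B C) \<and> card (B C) \<le> L * Suc d ^ k" if C: "C \<in> cycles G L" "L \<in> {3..Suc k}" for C L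
  proof -
    have "L > 0" using C by auto
    note fc = cycles_finite_card[OF C(1) this]
    have "card (B C) \<le> (\<Sum>u\<in>\<Union>C. card (nb_ball (edges G) k u))"
      unfolding B_def by (rule card_UN_le[OF fc(1)])
    also have "\<dots> \<le> (\<Sum>u\<in>\<Union>C. Suc d ^ k)" using nb_ball_finite_card[of "edges G" d k, OF deg] by (intro sum_mono) auto
    also have "\<dots> \<le> L * Suc d ^ k" using fc(2) by simp
    finally have "card (B C) \<le> L * Suc d ^ k" .
    moreover have "finite (B C)"
      unfolding B_def using fc(1) nb_ball_finite_card[of "edges G" d k, OF deg] by (intro finite_UN_I) auto
    ultimately show ?thesis by simp
  qed
  have "{v \<in> verts G. \<not> locally_tree (edges G) k v} \<subseteq> (\<Union>L\<in>{3..Suc k}. \<Union>C\<in>cycles G L. B C)"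
  proof
    fix v assume "v \<in> {v \<in> verts G. \<not> locally_tree (edges G) k v}"
    then have "\<not> locally_tree (edges G) k v" by simp
    then obtain L C u where "3 \<le> L" "L \<le> Suc k" "C \<in> cycles G L" "u \<in> \<Union>C" "v \<in> nb_ball (edges G) k u"
      by (rule not_locally_tree_near_cycle)
    then show "v \<in> (\<Union>L\<in>{3..Suc k}. \<Union>C\<in>cycles G L. B C)" unfolding B_def by (intro UN_I) auto
  qed
  then have "card {v \<in> verts G. \<not> locally_tree (edges G) k v} \<le> card (\<Union>L\<in>{3..Suc k}. \<Union>C\<in>cycles G L. B C)"
    using fin_cycles B_bound by (intro card_mono finite_UN_I) auto
  also have "\<dots> \<le> (\<Sum>L\<in>{3..Suc k}. card (\<Union>C\<in>cycles G L. B C))" by (rule card_UN_le) simp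
  also have "\<dots> \<le> (\<Sum>L\<in>{3..Suc k}. \<Sum>C\<in>cycles G L. card (B C))"
    by (intro sum_mono card_UN_le fin_cycles)
  also have "\<dots> \<le> (\<Sum>L\<in>{3..Suc k}. \<Sum>C\<in>cycles G L. L * Suc d ^ k)"
    using B_bound by (intro sum_mono) auto
  finally show ?thesis by simp
qed

lemma regular_graph_neighbours:
  assumes G: "finite_graph G" and reg: "regular_graph d G"
  shows "v \<in> verts G \<Longrightarrow> card (neighbours (edges G) v) = d" "neighbours (edges G) v \<subseteq> verts G"
    "finite (neighbours (edges G) v)" "card (neighbours (edges G) v) \<le> d"
proof -
  have E: "edges G \<subseteq> {e. e \<subseteq> verts G \<and> card e = 2}" and fin: "finite (verts G)"
    using G by (auto simp: finite_graph_def)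
  have card: "card (neighbours (edges G) v) = d" if v: "v \<in> verts G" for v
  proof -
    have "bij_betw (\<lambda>u. {v, u}) (neighbours (edges G) v) {e \<in> edges G. v \<in> e}"
      unfolding bij_betw_def
    proof
      show "inj_on (\<lambda>u. {v, u}) (neighbours (edges G) v)" by (auto simp: inj_on_def doubleton_eq_iff)
      have "e \<in> (\<lambda>u. {v, u}) ` neighbours (edges G) v" if e: "e \<in> edges G" "v \<in> e" for e
      proof -
        have "card e = 2" using e E by auto
        then obtain u where "e = {v, u}" using e(2) by (auto simp: card_2_iff)
        then show ?thesis using e by (auto simp: neighbours_def)
      qed
      then show "(\<lambda>u. {v, u}) ` neighbours (edges G) v = {e \<in> edges G. v \<in> e}"
        by (auto simp: neighbours_def)
    qed
    then show ?thesis using reg v by (auto simp: regular_graph_def dest: bij_betw_same_card)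
  qed
  then show "v \<in> verts G \<Longrightarrow> card (neighbours (edges G) v) = d" .
  show sub: "neighbours (edges G) v \<subseteq> verts G" using E by (auto simp: neighbours_def)
  then show "finite (neighbours (edges G) v)" using fin by (rule finite_subset)
  have "neighbours (edges G) v = {}" if "v \<notin> verts G" using that E by (auto simp: neighbours_def)
  then show "card (neighbours (edges G) v) \<le> d" using card[of v] by (cases "v \<in> verts G") auto
qed

lemma average_match_ratio_near_tree:
  assumes d: "d \<ge> 2" and z: "z \<ge> 2 * real d" and G: "finite_graph G" and reg: "regular_graph d G"
  defines "m \<equiv> 1 / (z - real d * tree_ratio d z)"
  shows "\<bar>(\<Sum>v\<in>verts G. match_ratio (edges G) (verts G) v z) / num_verts G - m\<bar> \<le>
    (1 / 2) ^ k + (\<Sum>L\<in>{3..Suc k}. real (card (cycles G L)) / num_verts G * real (L * Suc d ^ k))"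
proof -
  interpret two_element_edges "edges G" by (rule two_element_edges_finite_graph[OF G])
  note nb = regular_graph_neighbours[OF G reg]
  let ?R = "\<lambda>v. match_ratio (edges G) (verts G) v z" and ?n = "num_verts G"
  let ?bad = "{v \<in> verts G. \<not> locally_tree (edges G) k v}"
  have fin: "finite (verts G)" and n: "real ?n > 0" using G by (auto simp: finite_graph_def num_verts_def card_gt_0_iff)
  have m: "\<bar>m\<bar> \<le> 1 / real d"
    using tree_ratio_props(5)[OF d z] d unfolding m_def by (simp add: frac_le)
  have bound: "\<bar>?R v - m\<bar> \<le> (1 / 2) ^ k + (if v \<in> ?bad then 1 else 0)" if v: "v \<in> verts G" for v
  proof (cases "v \<in> ?bad")
    case True
    have "\<bar>?R v\<bar> \<le> 1 / real d"
      using match_sum_large_argument[OF fin _ _ nb(3,4), of z] d z v by auto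
    moreover have "1 / real d \<le> 1 / 2" using d by (intro divide_left_mono) auto
    moreover have "(0::real) \<le> (1 / 2) ^ k" by simp
    ultimately have "\<bar>?R v - m\<bar> \<le> (1 / 2) ^ k + 1" using m by linarith
    then show ?thesis using True by simp
  next
    case False
    then have "locally_tree (edges G) k v" using v by simp
    from match_ratio_locally_tree[OF fin d z nb(3,4) _ this v] nb(1,2) False
    show ?thesis unfolding m_def by auto
  qed
  have "(\<Sum>v\<in>verts G. ?R v) / ?n - m = (\<Sum>v\<in>verts G. ?R v - m) / ?n"
    using n by (simp add: sum_subtractf num_verts_def field_simps)
  then have "\<bar>(\<Sum>v\<in>verts G. ?R v) / ?n - m\<bar> = \<bar>\<Sum>v\<in>verts G. ?R v - m\<bar> / ?n" by simp
  also have "\<bar>\<Sum>v\<in>verts G. ?R v - m\<bar> \<le> (\<Sum>v\<in>verts G. (1 / 2) ^ k + (if v \<in> ?bad then 1 else 0))"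
    using bound by (intro order.trans[OF sum_abs] sum_mono) auto
  also have "\<dots> = ?n * (1 / 2) ^ k + card ?bad"
    using fin by (simp add: sum.distrib num_verts_def sum.If_cases Int_def conj_commute)
  also have "real (card ?bad) \<le> (\<Sum>L\<in>{3..Suc k}. real (card (cycles G L)) * real (L * Suc d ^ k))"
    using card_not_locally_tree[OF G nb(3,4), of k] by (simp flip: of_nat_mult of_nat_sum of_nat_power of_nat_Suc)
  finally have "\<bar>(\<Sum>v\<in>verts G. ?R v) / ?n - m\<bar> \<le>
      (?n * (1 / 2) ^ k + (\<Sum>L\<in>{3..Suc k}. real (card (cycles G L)) * real (L * Suc d ^ k))) / ?n"
    using n by (simp add: divide_right_mono)
  also have "\<dots> = (1 / 2) ^ k + (\<Sum>L\<in>{3..Suc k}. real (card (cycles G L)) / ?n * real (L * Suc d ^ k))"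
    using n by (simp add: add_divide_distrib sum_divide_distrib)
  finally show ?thesis .
qed

lemma average_match_ratio_tendsto:
  assumes d: "d \<ge> 2" and z: "z \<ge> 2 * real d"
    and G: "\<And>n. finite_graph (G n)" and reg: "\<And>n. regular_graph d (G n)"
    and girth: "essentially_large_girth G"
  shows "(\<lambda>n. (\<Sum>v\<in>verts (G n). match_ratio (edges (G n)) (verts (G n)) v z) / num_verts (G n))
    \<longlonglongrightarrow> 1 / (z - real d * tree_ratio d z)"
proof (rule LIMSEQ_uniform_approx)
  fix e :: real assume e: "e > 0"
  let ?m = "1 / (z - real d * tree_ratio d z)"
  obtain k where k: "(1 / 2 :: real) ^ k < e / 2"
    using real_arch_pow_inv[of "e / 2" "1 / 2"] e by auto
  have "(\<lambda>n. real (card (cycles (G n) L)) / num_verts (G n)) \<longlonglongrightarrow> 0" if "L \<in> {3..Suc k}" for L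
    using girth that by (auto simp: essentially_large_girth_def intro!: smalloD_tendsto)
  then have "(\<lambda>n. \<Sum>L\<in>{3..Suc k}. real (card (cycles (G n) L)) / num_verts (G n) * real (L * Suc d ^ k)) \<longlonglongrightarrow> 0"
    by (intro tendsto_null_sum tendsto_mult_left_zero)
  then have "\<forall>\<^sub>F n in sequentially.
      (\<Sum>L\<in>{3..Suc k}. real (card (cycles (G n) L)) / num_verts (G n) * real (L * Suc d ^ k)) < e / 2"
    using e by (intro order_tendstoD(2)) auto
  then have "\<forall>\<^sub>F n in sequentially.
      \<bar>(\<Sum>v\<in>verts (G n). match_ratio (edges (G n)) (verts (G n)) v z) / num_verts (G n) - ?m\<bar> \<le> e"
    by eventually_elim (use average_match_ratio_near_tree[OF d z G reg, where k = k] k in \<open>smt (verit) field_sum_of_halves\<close>)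
  then show "\<exists>Y l. Y \<longlonglongrightarrow> l \<and> (\<forall>\<^sub>F n in sequentially.
      \<bar>(\<Sum>v\<in>verts (G n). match_ratio (edges (G n)) (verts (G n)) v z) / num_verts (G n) - Y n\<bar> \<le> e) \<and> \<bar>?m - l\<bar> \<le> e"
    using e by (intro exI[of _ "\<lambda>_. ?m"] exI[of _ ?m]) auto
qed

theorem theorem4p1:
  fixes d :: nat and G :: "nat \<Rightarrow> 'a graph"
  assumes "d \<ge> 2"
    and "\<And>n. finite_graph (G n)"
    and "\<And>n. regular_graph d (G n)"
    and "essentially_large_girth G"
  shows "prob_space (limit_measure d) \<and>
    weak_conv_m (\<lambda>n. matching_measure (G n)) (limit_measure d)"
proof
  note dist = real_distribution_limit_measure[OF assms(1)] real_distribution_matching_measure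
  show "prob_space (limit_measure d)" using dist(1) by (simp add: real_distribution_def)
  have d: "d > 0" using assms(1) by simp
  have supp: "AE x in matching_measure (G n). \<bar>x\<bar> \<le> 2 * real d" for n
    by (rule AE_matching_measure[OF assms(2) d regular_graph_neighbours(3,4)[OF assms(2)[of n] assms(3)[of n]]])
  show "weak_conv_m (\<lambda>n. matching_measure (G n)) (limit_measure d)"
  proof (rule moments_imp_weak_conv_m[OF dist(2,1) supp AE_limit_measure[OF assms(1)]],
      rule stieltjes_imp_moments[OF dist(2,1) _ supp AE_limit_measure[OF assms(1)]])
    fix z :: real assume "2 * (2 * real d) < z"
    then have z: "z \<ge> 2 * real d" "z > real d" using d by auto
    have nz: "match_sum (edges (G n)) (verts (G n)) z \<noteq> 0" for n
    proof -
      interpret two_element_edges "edges (G n)" by (rule two_element_edges_finite_graph[OF assms(2)])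
      show ?thesis
        using match_sum_large_argument[OF _ d _ regular_graph_neighbours(3,4)[OF assms(2)[of n] assms(3)[of n]],
            of "verts (G n)" z] z assms(2)[of n] by (auto simp: finite_graph_def)
    qed
    show "(\<lambda>n. \<integral>x. 1 / (z - x) \<partial>matching_measure (G n)) \<longlonglongrightarrow> (\<integral>x. 1 / (z - x) \<partial>limit_measure d)"
      unfolding stieltjes_matching_measure[OF assms(2) nz] stieltjes_limit_measure[OF assms(1) z(2)]
        tree_ratio_props(6)[OF assms(1) z(1), symmetric]
      by (rule average_match_ratio_tendsto[OF assms(1) z(1) assms(2-4)])
  qed (use d in simp)
qed

end
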